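(* There exist numerical constants $c_0,c_1>0$ such that, for any $G,\rho,\Delta>0$ and any $\epsilon>0$ satisfying $\epsilon^2\le c_0\min\{G^2,\rho\Delta\}$, there exists $f\in\mathcal F(G,\rho,\Delta)$ such that $$\mathcal T_\epsilon(\mathcal A_{\mathrm{zr}},\{f\})\;\ge\; c_1\,\frac{G^2\min\{\rho\Delta,G^2\}}{\epsilon^4}.$$
   Context: All norms are Euclidean; $\mathbb N=\{0,1,2,\dots\}$; $\inf\varnothing=+\infty$. Function class. A function $f:\mathbb R^d\to\mathbb R$ is $\rho$-weakly convex if $f+\frac{\rho}{2}\|\cdot\|^2$ is convex, and weakly convex if this holds for some $\rho>0$. For $G,\rho,\Delta>0$, $\mathcal F(G,\rho,\Delta)$ is the union over all dimensions $d$ of the sets of functions $f:\mathbb R^d\to\mathbb R$ that are $\rho$-weakly convex, $G$-Lipschitz ($|f(x)-f(y)|\le G\|x-y\|$ for all $x,y$), and satisfy $f(\mathbf 0)-\inf_{x\in\mathbb R^d}f(x)\le\Delta$. Subdifferential. $\partial f(x)$ is the subdifferential of the weakly convex function $f$ at $x$ (all standard notions coincide; e.g. the set of $g$ with $\liminf_{y\to x,\,y\ne x}\frac{f(y)-f(x)-\langle g,y-x\rangle}{\|y-x\|}\ge 0$). Stationarity. The Moreau envelope is $f_{1/(2\rho)}(x):=\min_{z\in\mathbb R^d}\{f(z)+\rho\|x-z\|^2\}$. For $f$ on $\mathbb R^d$ in $\mathcal F(G,\rho,\Delta)$, a point $x$ is $\epsilon$-stationary if $\|\nabla f_{1/(2\rho)}(x)\|\le\epsilon$.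 Oracle. At a query point $x$ the oracle returns the function value and the full subdifferential set, $\mathbb O_f(x)=(f(x),\partial f(x))$. Algorithms. A deterministic first-order algorithm $\mathsf A$ produces, for each weakly convex $f:\mathbb R^d\to\mathbb R$ (in any dimension $d$), queries $x^0=\mathbf 0$ and $x^t=\Gamma_t\big((\mathbb O_f(x^s))_{s<t}\big)\in\mathbb R^d$, $t\ge1$, where the maps $\Gamma_t$ (possibly depending on the dimension $d$) do not otherwise depend on $f$. Write $\mathsf A^{(t)}[f]:=x^t$. For a vector $a$, $\operatorname{supp}(a)$ is the set of indices of its nonzero coordinates; for a set $S\subseteq\mathbb R^d$, $\operatorname{supp}(S):=\bigcup_{g\in S}\operatorname{supp}(g)$. $\mathcal A_{\mathrm{zr}}$ is the class of generalized zero-respecting algorithms, i.e. deterministic first-order algorithms such that for every weakly convex $f$ the queries satisfy $\operatorname{supp}(x^t)\subseteq\bigcup_{s<t}\operatorname{supp}(\partial f(x^s))$ for all $t\ge1$. Complexity. For a class of algorithms $\mathcal A$ and a class of functions $\mathcal H$, $$\mathcal T_\epsilon(\mathcal A,\mathcal H):=\inf_{\mathsf A\in\mathcal A}\ \sup_{f\in\mathcal H}\ \inf\{t\in\mathbb N : \mathsf A^{(t)}[f]\text{ is an }\epsilon\text{-stationary point of }f\}.$$ *)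

theory Defs
  imports "HOL-Analysis.Analysis"
begin

text \<open>
  The dimension is existentially quantified, so it cannot be a type parameter. All spaces
  \<open>\<real>\<^sup>d\<close> are therefore realised inside one inner product space, the finitely supported real
  sequences with the Euclidean inner product: \<open>\<real>\<^sup>d\<close> is the subspace of those sequences that
  vanish at all indices \<open>i \<ge> d\<close>. (The library norm on \<open>poly_mapping\<close> is the 1-norm, so that
  type is not usable here.)
\<close>

typedef fseq = "{x :: nat \<Rightarrow> real. finite {i. x i \<noteq> 0}}"
  morphisms coord Abs_fseq
proof
  show "(\<lambda>_. 0) \<in> {x :: nat \<Rightarrow> real. finite {i. x i \<noteq> 0}}"
    by simp
qed

setup_lifting type_definition_fseq

definition supp :: "fseq \<Rightarrow> nat set" where
  "supp x = {i. coord x i \<noteq> 0}"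

lemma finite_supp [simp]: "finite (supp x)"
  using coord[of x] by (simp add: supp_def)

lemma fseq_eqI: "(\<And>i. coord x i = coord y i) \<Longrightarrow> x = y"
  by (metis coord_inject ext)

instantiation fseq :: real_vector
begin

lift_definition zero_fseq :: fseq is "\<lambda>_. 0"
  by simp

lift_definition plus_fseq :: "fseq \<Rightarrow> fseq \<Rightarrow> fseq" is "\<lambda>x y i. x i + y i"
proof -
  fix x y :: "nat \<Rightarrow> real"
  assume "finite {i. x i \<noteq> 0}" "finite {i. y i \<noteq> 0}"
  then show "finite {i. x i + y i \<noteq> 0}"
    by (rule finite_subset[rotated, OF finite_UnI]) auto
qed

lift_definition minus_fseq :: "fseq \<Rightarrow> fseq \<Rightarrow> fseq" is "\<lambda>x y i. x i - y i"
proof -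
  fix x y :: "nat \<Rightarrow> real"
  assume "finite {i. x i \<noteq> 0}" "finite {i. y i \<noteq> 0}"
  then show "finite {i. x i - y i \<noteq> 0}"
    by (rule finite_subset[rotated, OF finite_UnI]) auto
qed

lift_definition uminus_fseq :: "fseq \<Rightarrow> fseq" is "\<lambda>x i. - x i"
  by simp

lift_definition scaleR_fseq :: "real \<Rightarrow> fseq \<Rightarrow> fseq" is "\<lambda>r x i. r * x i"
  by (rule finite_subset[rotated]) auto

instance
  by (intro_classes; transfer) (auto simp: algebra_simps)

end

lemma coord_zero [simp]: "coord 0 i = 0"
  by transfer simp

lemma coord_add [simp]: "coord (x + y) i = coord x i + coord y i"
  by transfer simp

lemma coord_diff [simp]: "coord (x - y) i = coord x i - coord y i"
  by transfer simp

lemma coord_uminus [simp]: "coord (- x) i = - coord x i"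
  by transfer simp

lemma coord_scaleR [simp]: "coord (r *\<^sub>R x) i = r * coord x i"
  by transfer simp

lemma sum_supp_superset:
  assumes "finite A" "supp x \<subseteq> A"
  shows "(\<Sum>i\<in>supp x. coord x i * coord y i) = (\<Sum>i\<in>A. coord x i * coord y i)"
  using assms by (intro sum.mono_neutral_left) (auto simp: supp_def)

instantiation fseq :: real_inner
begin

definition inner_fseq :: "fseq \<Rightarrow> fseq \<Rightarrow> real" where
  "inner_fseq x y = (\<Sum>i\<in>supp x. coord x i * coord y i)"

definition norm_fseq :: "fseq \<Rightarrow> real" where
  "norm_fseq x = sqrt (inner x x)"

definition dist_fseq :: "fseq \<Rightarrow> fseq \<Rightarrow> real" where
  "dist_fseq x y = norm (x - y)"

definition sgn_fseq :: "fseq \<Rightarrow> fseq" where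
  "sgn_fseq x = x /\<^sub>R norm x"

definition uniformity_fseq :: "(fseq \<times> fseq) filter" where
  "uniformity_fseq = (INF e\<in>{0<..}. principal {(x, y). dist x y < e})"

definition open_fseq :: "fseq set \<Rightarrow> bool" where
  "open_fseq U \<longleftrightarrow> (\<forall>x\<in>U. \<forall>\<^sub>F (x', y) in uniformity. x' = x \<longrightarrow> y \<in> U)"

instance
proof
  fix x y z :: fseq and r :: real
  let ?A = "supp x \<union> supp y"
  show "dist x y = norm (x - y)" by (simp add: dist_fseq_def)
  show "sgn x = x /\<^sub>R norm x" by (simp add: sgn_fseq_def)
  show "uniformity = (INF e\<in>{0<..}. principal {(x, y :: fseq). dist x y < e})"
    by (simp add: uniformity_fseq_def)
  show "open U \<longleftrightarrow> (\<forall>x\<in>U. \<forall>\<^sub>F (x', y) in uniformity. x' = x \<longrightarrow> y \<in> U)" for U :: "fseq set"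
    by (simp add: open_fseq_def)
  show "norm x = sqrt (inner x x)" by (simp add: norm_fseq_def)
  show "inner x y = inner y x"
    unfolding inner_fseq_def
    using sum_supp_superset[of ?A x y] sum_supp_superset[of ?A y x] by (simp add: mult.commute)
  have sub: "supp (x + y) \<subseteq> ?A" by (auto simp: supp_def)
  show "inner (x + y) z = inner x z + inner y z"
    unfolding inner_fseq_def
    using sum_supp_superset[of ?A "x + y" z] sum_supp_superset[of ?A x z]
      sum_supp_superset[of ?A y z] sub
    by (simp add: sum.distrib distrib_right)
  have sub': "supp (r *\<^sub>R x) \<subseteq> supp x" by (auto simp: supp_def)
  show "inner (r *\<^sub>R x) y = r * inner x y"
    unfolding inner_fseq_def
    using sum_supp_superset[of "supp x" "r *\<^sub>R x" y] sub'
    by (simp add: sum_distrib_left mult.assoc)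
  show "0 \<le> inner x x"
    unfolding inner_fseq_def by (intro sum_nonneg) auto
  show "inner x x = 0 \<longleftrightarrow> x = 0"
    unfolding inner_fseq_def
    by (subst sum_nonneg_eq_0_iff[OF finite_supp]) (auto simp: supp_def intro!: fseq_eqI)
qed

end

definition Rd :: "nat \<Rightarrow> fseq set" where
  "Rd d = {x. supp x \<subseteq> {..<d}}"

text \<open>
  A function on \<open>\<real>\<^sup>d\<close> is a function on \<^typ>\<open>fseq\<close> of which only the values on \<^term>\<open>Rd d\<close>
  matter: every notion below is relative to \<^term>\<open>Rd d\<close>.
\<close>

definition weakly_convex_with :: "real \<Rightarrow> nat \<Rightarrow> (fseq \<Rightarrow> real) \<Rightarrow> bool" where
  "weakly_convex_with \<rho> d f \<longleftrightarrow> convex_on (Rd d) (\<lambda>x. f x + \<rho> / 2 * (norm x)\<^sup>2)"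

definition weakly_convex :: "nat \<Rightarrow> (fseq \<Rightarrow> real) \<Rightarrow> bool" where
  "weakly_convex d f \<longleftrightarrow> (\<exists>\<rho>>0. weakly_convex_with \<rho> d f)"

text \<open>The infimum is taken in \<^typ>\<open>ereal\<close>, so functions unbounded below are excluded.\<close>

definition function_class :: "real \<Rightarrow> real \<Rightarrow> real \<Rightarrow> (nat \<times> (fseq \<Rightarrow> real)) set" where
  "function_class G \<rho> \<Delta> = {(d, f).
     weakly_convex_with \<rho> d f \<and>
     G-lipschitz_on (Rd d) f \<and>
     ereal (f 0) - (INF x\<in>Rd d. ereal (f x)) \<le> ereal \<Delta>}"

definition subdifferential :: "nat \<Rightarrow> (fseq \<Rightarrow> real) \<Rightarrow> fseq \<Rightarrow> fseq set" where
  "subdifferential d f x = {g \<in> Rd d.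
     0 \<le> Liminf (at x within Rd d) (\<lambda>y. ereal ((f y - f x - inner g (y - x)) / norm (y - x)))}"

text \<open>
  The Moreau envelope of \<open>f\<close> with parameter \<open>1 / (2 * \<rho>)\<close>. Its defining minimum is written as
  an infimum; for \<open>\<rho>\<close>-weakly convex \<open>f\<close> it is attained, the objective being strongly convex.
\<close>

definition moreau_envelope :: "nat \<Rightarrow> real \<Rightarrow> (fseq \<Rightarrow> real) \<Rightarrow> fseq \<Rightarrow> real" where
  "moreau_envelope d \<rho> f x = (INF z\<in>Rd d. f z + \<rho> * (norm (x - z))\<^sup>2)"

definition has_gradient :: "nat \<Rightarrow> (fseq \<Rightarrow> real) \<Rightarrow> fseq \<Rightarrow> fseq \<Rightarrow> bool" where
  "has_gradient d h x g \<longleftrightarrow> g \<in> Rd d \<and> (h has_derivative inner g) (at x within Rd d)"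

text \<open>
  Gradients are unique, lying in \<^term>\<open>Rd d\<close>, and the envelope of a \<open>\<rho>\<close>-weakly convex function
  is differentiable everywhere, so the existential selects the gradient of the envelope.
\<close>

definition stationary :: "nat \<Rightarrow> real \<Rightarrow> real \<Rightarrow> (fseq \<Rightarrow> real) \<Rightarrow> fseq \<Rightarrow> bool" where
  "stationary d \<rho> \<epsilon> f x \<longleftrightarrow> (\<exists>g. has_gradient d (moreau_envelope d \<rho> f) x g \<and> norm g \<le> \<epsilon>)"

type_synonym answer = "real \<times> fseq set"

definition oracle_answer :: "nat \<Rightarrow> (fseq \<Rightarrow> real) \<Rightarrow> fseq \<Rightarrow> answer" where
  "oracle_answer d f x = (f x, subdifferential d f x)"

text \<open>
  \<open>\<Gamma> d t\<close> maps the list of the first \<open>t\<close> oracle answers to the query \<open>x\<^sup>t\<close>.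
\<close>

type_synonym algorithm = "nat \<Rightarrow> nat \<Rightarrow> answer list \<Rightarrow> fseq"

fun query :: "algorithm \<Rightarrow> nat \<Rightarrow> (fseq \<Rightarrow> real) \<Rightarrow> nat \<Rightarrow> fseq" where
  "query \<Gamma> d f 0 = 0"
| "query \<Gamma> d f (Suc t) =
     \<Gamma> d (Suc t) (map (\<lambda>s. oracle_answer d f (query \<Gamma> d f s)) [0..<Suc t])"

definition first_order_algorithms :: "algorithm set" where
  "first_order_algorithms =
     {\<Gamma>. \<forall>d f. weakly_convex d f \<longrightarrow> (\<forall>t. query \<Gamma> d f t \<in> Rd d)}"

definition zero_respecting :: "algorithm set" where
  "zero_respecting = {\<Gamma> \<in> first_order_algorithms.
     \<forall>d f. weakly_convex d f \<longrightarrow>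
       (\<forall>t\<ge>1. supp (query \<Gamma> d f t) \<subseteq>
          (\<Union>s<t. \<Union>g\<in>subdifferential d f (query \<Gamma> d f s). supp g))}"

text \<open>
  \<open>\<rho>\<close> enters because it fixes the Moreau parameter in the notion of stationarity.
  In \<^typ>\<open>enat\<close> the infimum of the empty set is \<open>\<infinity>\<close>.
\<close>

definition complexity ::
  "real \<Rightarrow> real \<Rightarrow> algorithm set \<Rightarrow> (nat \<times> (fseq \<Rightarrow> real)) set \<Rightarrow> enat" where
  "complexity \<rho> \<epsilon> \<A> \<H> =
     (INF \<Gamma>\<in>\<A>. SUP (d, f)\<in>\<H>. Inf {enat t | t. stationary d \<rho> \<epsilon> f (query \<Gamma> d f t)})"

end

theory Submission
  imports Defs
begin

text \<open>
  The hard function is a rescaling of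
  \<open>max 0 (max\<^sub>i (1 - (1/n) \<Sum>\<^bsub>j \<le> i - n\<^esub> \<omega>(x\<^sub>j) - \<delta> i - x\<^sub>i)) + (2/n) \<Sum>\<^bsub>j < N\<^esub> \<omega>(x\<^sub>j)\<close>,
  where \<open>\<omega>\<close> (\<open>deficit\<close> below) measures how far a coordinate is from being raised to 1. As
  \<open>\<omega>'(0) = 0\<close> and the tilt \<open>\<delta>\<close> separates the untouched coordinates, the full subdifferential at
  a point supported in the first \<open>k\<close> coordinates reveals only one more coordinate.

  Every piece of the maximum, with the sum added, is nonincreasing in every coordinate, so
  subgradients cannot cancel: near a nearly stationary point with at least \<open>n\<close> coordinates untouched
  the maximum would have to be shared by many more than \<open>n\<close> indices. The gate \<open>1 - (1/n) \<Sum> \<omega>\<close> rules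
  this out, because an index can be active only while the total deficit well before it is of order
  \<open>n\<close>. Sharing among \<open>n \<approx> G\<^sup>2/\<epsilon>\<^sup>2\<close> indices leaves a gradient of size \<open>G/\<surd>n \<approx> \<epsilon>\<close>.

  Only convex kinks and the curvature \<open>1/n\<close> of the separable \<open>\<omega>\<close>-terms occur, and the budget \<open>\<Delta>\<close>
  pays for \<open>N \<approx> n min(\<rho>\<Delta>, G\<^sup>2)/\<epsilon>\<^sup>2\<close> coordinates. The Lipschitz bound needs \<open>N \<le> n\<^sup>2\<close>, whence the
  minimum.
\<close>

section \<open>The deficit of a coordinate\<close>

text \<open>Nonincreasing with slope between -1 and 0, and C^1 apart from a convex kink at 1. The
  slope vanishes only at 0 and beyond 1, and the curvature is nowhere below -1.\<close>

definition deficit :: "real \<Rightarrow> real" where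
  "deficit x = (if x \<ge> 1 then 0 else if x \<ge> 0 then (1 - x\<^sup>2) / 2
     else if x \<ge> -1 then (1 + x\<^sup>2) / 2 else - x)"

lemma deficit_nonneg: "0 \<le> deficit x"
  by (auto simp: deficit_def power_le_one)

text \<open>The vanishing slope at 0, in the quadratic form that hides an untouched coordinate from
  the oracle.\<close>

lemma deficit_near_zero: "\<bar>deficit t - deficit 0\<bar> \<le> t\<^sup>2 / 2"
proof -
  have "0 \<le> (t + 1)\<^sup>2" by simp
  then have "- t - 1 / 2 \<le> t\<^sup>2 / 2" by (simp add: power2_eq_square field_simps)
  moreover have "1 \<le> t\<^sup>2" if "t \<ge> 1" using that by simp
  ultimately show ?thesis by (auto simp: deficit_def abs_if field_simps)
qed

text \<open>The curvature is at worst -1, on (0, 1), and the kink at 1 is convex. The pointwise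
  inequality can be summed with nonnegative weights.\<close>

lemma deficit_weakly_convex:
  "\<exists>d. \<forall>y. deficit x + d * (y - x) - (y - x)\<^sup>2 / 2 \<le> deficit y"
proof -
  \<comment> \<open>The derivative of \<open>deficit\<close>, taken from the right at 1.\<close>
  define d where "d = (if x \<ge> 1 then 0 else if x \<ge> 0 then - x else if x \<ge> -1 then x else -1)"
  have "deficit x + d * (y - x) - (y - x)\<^sup>2 / 2 \<le> deficit y" for y
  proof -
    have sq: "0 \<le> (y + 1)\<^sup>2" "0 \<le> (y - 1)\<^sup>2" "0 \<le> (x - y)\<^sup>2" by simp_all
    \<comment> \<open>For x in [0, 1) the left side of the claim is exactly this parabola.\<close>
    have lower: "(1 - y\<^sup>2) / 2 \<le> deficit y"
      using sq by (auto simp: deficit_def power2_eq_square field_simps)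
    consider "x \<ge> 1" | "0 \<le> x" "x < 1" | "-1 \<le> x" "x < 0" | "x < -1" by linarith
    then show ?thesis
    proof cases
      case 1
      then show ?thesis
        using order_trans[OF _ deficit_nonneg[of y], of "- ((y - x)\<^sup>2 / 2)"]
        by (simp add: deficit_def[of x] d_def)
    next
      case 2
      have "(1 - x\<^sup>2) / 2 + - x * (y - x) - (y - x)\<^sup>2 / 2 = (1 - y\<^sup>2) / 2"
        by (simp add: power2_eq_square field_simps)
      moreover have def_x: "deficit x = (1 - x\<^sup>2) / 2" "d = - x"
        using 2 by (simp_all add: deficit_def d_def)
      ultimately show ?thesis using lower unfolding def_x by linarith
    next
      case 3
      have eq: "(1 + x\<^sup>2) / 2 + x * (y - x) - (y - x)\<^sup>2 / 2 = 1 / 2 - y\<^sup>2 / 2 - x\<^sup>2 + (x * y + x * y)"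
        by (simp add: power2_eq_square field_simps)
      have "1 / 2 - y\<^sup>2 / 2 - x\<^sup>2 + (x * y + x * y) \<le> deficit y"
      proof (cases "y \<ge> 0")
        case True
        then have "x * y \<le> 0" using 3 by (simp add: mult_nonpos_nonneg)
        moreover have "0 \<le> x\<^sup>2" by simp
        ultimately show ?thesis using lower[unfolded diff_divide_distrib] by linarith
      next
        case False
        show ?thesis
        proof (cases "y \<ge> -1")
          case True
          then show ?thesis using False sq(3)
            by (simp add: deficit_def power2_eq_square field_simps)
        next
          case False
          have "0 \<le> (x + 1) * (x - 1 - 2 * y)" using 3 False by simp
          then show ?thesis using sq(1) False 3
            by (simp add: deficit_def power2_eq_square field_simps)
        qed
      qed
      then show ?thesis using 3 eq by (simp add: deficit_def d_def)
    next
      case 4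
      have "- y - (y - x)\<^sup>2 / 2 \<le> deficit y"
      proof (cases "y \<ge> 0")
        case True
        have "y\<^sup>2 \<le> (y - x)\<^sup>2" using True 4 by (intro power_mono) auto
        moreover have "(y + 1)\<^sup>2 \<le> (y - x)\<^sup>2" using True 4 by (intro power_mono) auto
        ultimately have "- y - (y - x)\<^sup>2 / 2 \<le> 0" using True by simp (smt (verit) zero_le_power2)
        then show ?thesis using deficit_nonneg[of y] by linarith
      next
        case False
        have "0 \<le> (y - x)\<^sup>2" by simp
        then show ?thesis using False sq(1)
          by (auto simp: deficit_def power2_eq_square field_simps)
      qed
      then show ?thesis using 4 by (simp add: deficit_def d_def)
    qed
  qed
  then show ?thesis by blast
qed

lemma deficit_lipschitz:
  assumes "x \<le> y"
  shows "deficit y \<le> deficit x" "deficit x - deficit y \<le> y - x"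
proof -
  consider "x \<ge> 1" | "0 \<le> x" "x < 1" | "-1 \<le> x" "x < 0" | "x < -1" by linarith
  then have mono: "deficit y \<le> deficit x \<and> deficit x - deficit y \<le> y - x"
  proof cases
    case 1 then show ?thesis using assms by (simp add: deficit_def)
  next
    case 2
    have "x\<^sup>2 \<le> y\<^sup>2" using 2 assms by simp
    moreover have "x\<^sup>2 \<le> 1" using 2 by (simp add: power_le_one)
    moreover have "0 \<le> (1 - x)\<^sup>2" by simp
    moreover have "0 \<le> (y - x) * (2 - x - y)" if "y < 1" using that 2 assms by simp
    ultimately show ?thesis using 2 assms
      by (auto simp: deficit_def power2_eq_square field_simps)
  next
    case 3
    have "0 \<le> x\<^sup>2" "0 \<le> (x + 1)\<^sup>2" "0 \<le> (y - 1)\<^sup>2" "0 \<le> y\<^sup>2" by simp_all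
    moreover have "x\<^sup>2 \<le> - x" using 3 mult_right_mono_neg[of "-1" x x] by (simp add: power2_eq_square)
    moreover have "0 \<le> (y - x) * (- x - y)" "0 \<le> (y - x) * (2 + x + y)" if "y < 0"
      using that 3 assms by simp_all
    moreover have "0 \<le> y - y\<^sup>2" if "0 \<le> y" "y < 1"
      using that mult_right_mono[of y 1 y] by (simp add: power2_eq_square)
    ultimately show ?thesis using 3 assms
      by (auto simp: deficit_def power2_eq_square field_simps not_le; smt (verit))
  next
    case 4
    have "0 \<le> y\<^sup>2" "0 \<le> (y + 1)\<^sup>2" "0 \<le> (y - 1)\<^sup>2" by simp_all
    moreover have "0 \<le> y - y\<^sup>2" if "0 \<le> y" "y < 1"
      using that mult_right_mono[of y 1 y] by (simp add: power2_eq_square)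
    moreover have "y\<^sup>2 \<le> - y" if "-1 \<le> y" "y < 0" using that mult_right_mono_neg[of "-1" y y] by (simp add: power2_eq_square)
    ultimately show ?thesis using 4 assms
      by (auto simp: deficit_def power2_eq_square field_simps not_le; smt (verit))
  qed
  then show "deficit y \<le> deficit x" "deficit x - deficit y \<le> y - x" by auto
qed

text \<open>
  A safe step for a coordinate in which \<open>deficit\<close> is steep. It vanishes near 0, where the slope of
  \<open>deficit\<close> does, and never crosses the kink at 1.
\<close>

definition slack :: "real \<Rightarrow> real" where
  "slack x = (if 1 / 4 \<le> x then max 0 (min (1 - x) (1 / 8)) else if x \<le> - (1 / 4) then 1 / 8 else 0)"

lemma slack_bounds: "0 \<le> slack x" "slack x \<le> 1 / 8"
  by (auto simp: slack_def max_def min_def)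

text \<open>On [1/4, 1] the deficit is at most 1 - x, which is at most 3/4 = 6 * 1/8.\<close>

lemma deficit_le_slack: "1 / 4 \<le> x \<Longrightarrow> deficit x \<le> 6 * slack x"
proof -
  assume "1 / 4 \<le> x"
  moreover have "0 \<le> (1 - x)\<^sup>2" by simp
  ultimately show ?thesis
    by (auto simp: slack_def deficit_def power2_eq_square field_simps max_def min_def)
qed

text \<open>A step of at most 1/8 from x <= -1/4 ends at or before -1/8, and one from x >= 1/4 stops
  at 1. On either path the slope is at most -1/8.\<close>

lemma deficit_decrease:
  assumes "0 \<le> t" "t \<le> 1"
  shows "t * slack x / 8 \<le> deficit x - deficit (x + t * slack x)"
proof -
  define u where "u = t * slack x"
  have u: "0 \<le> u" "u \<le> slack x" 
    using assms slack_bounds[of x] by (auto simp: u_def mult_left_le_one_le)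
  have "u / 8 \<le> deficit x - deficit (x + u)"
  proof (cases "x \<le> - (1 / 4)")
    case True
    then have u8: "u \<le> 1 / 8" using u by (simp add: slack_def)
    have p: "0 \<le> u * (- x - u/2 - 1/8)" using u u8 True by simp
    show ?thesis
    proof (cases "x \<ge> -1")
      case t: True
      then show ?thesis using True u u8 p
        by (auto simp: deficit_def power2_eq_square field_simps)
    next
      case f: False
      show ?thesis
      proof (cases "-1 \<le> x + u")
        case t: True
        have "(x + u + 1) * (x + u + 1) \<le> u * u"
          using t f u by (intro mult_mono) auto
        moreover have "u * u \<le> u / 8" using u u8 mult_left_mono[of u "1/8" u] by simp
        moreover have "deficit x = - x" "deficit (x + u) = (1 + (x + u) * (x + u)) / 2"
          using f t True u8 by (simp_all add: deficit_def power2_eq_square)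
        ultimately show ?thesis using u by (simp add: algebra_simps)
      next
        case False
        then show ?thesis using f u by (simp add: deficit_def)
      qed
    qed
  next
    case False
    show ?thesis
    proof (cases "1 / 4 \<le> x \<and> x < 1")
      case True
      then have "u \<le> 1 - x" using u by (simp add: slack_def)
      moreover have "u / 4 \<le> u * x" using True u mult_left_mono[of "1/4" x u] by simp
      moreover have "2 * deficit x = 1 - x * x" using True by (simp add: deficit_def power2_eq_square)
      moreover have "2 * deficit (x + u) = 1 - (x + u) * (x + u)"
      proof (cases "x + u = 1")
        case f: False
        then have "x + u < 1" using \<open>u \<le> 1 - x\<close> by simp
        then show ?thesis using True u by (simp add: deficit_def power2_eq_square)
      qed (simp add: deficit_def)
      moreover have "(x + u) * (x + u) = x * x + (u * x + u * x) + u * u" by algebra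
      moreover have "0 \<le> u * u" by simp
      ultimately show ?thesis using u(1) by linarith
    next
      case f: False
      then have "u = 0" using u False by (auto simp: slack_def split: if_splits)
      then show ?thesis by simp
    qed
  qed
  then show ?thesis by (simp add: u_def)
qed

section \<open>The hard function on coordinate sequences\<close>

locale chain =
  fixes n N :: nat
  assumes n_pos: "0 < n" and N_pos: "0 < N"
begin

text \<open>Truncated subtraction is intended: \<^term>\<open>j < Suc i - n\<close> means \<^term>\<open>j + n \<le> i\<close>.\<close>

definition piece :: "nat \<Rightarrow> (nat \<Rightarrow> real) \<Rightarrow> real" where
  "piece i x = 1 - (\<Sum>j<Suc i - n. deficit (x j)) / n - i / (16 * N) - x i"

definition peak :: "(nat \<Rightarrow> real) \<Rightarrow> real" where
  "peak x = Max (insert 0 ((\<lambda>i. piece i x) ` {..<N}))"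

definition hard :: "(nat \<Rightarrow> real) \<Rightarrow> real" where
  "hard x = peak x + 2 / n * (\<Sum>j<N. deficit (x j))"

lemma piece_le_peak: "i < N \<Longrightarrow> piece i x \<le> peak x"
  and peak_nonneg: "0 \<le> peak x"
  by (simp_all add: peak_def)

lemma peak_leI: "0 \<le> c \<Longrightarrow> (\<And>i. i < N \<Longrightarrow> piece i x \<le> c) \<Longrightarrow> peak x \<le> c"
  by (auto simp: peak_def)

lemma peak_cases: "peak x = 0 \<or> (\<exists>i<N. peak x = piece i x)"
proof -
  have "peak x \<in> insert 0 ((\<lambda>i. piece i x) ` {..<N})"
    unfolding peak_def by (rule Max_in) auto
  then show ?thesis by auto
qed

lemma piece_le: "piece i x \<le> 1 - (\<Sum>j<Suc i - n. deficit (x j)) / n - x i"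
  by (simp add: piece_def)

lemma hard_nonneg: "0 \<le> hard x"
  by (simp add: hard_def peak_nonneg sum_nonneg deficit_nonneg)

lemma hard_zero_le: "hard (\<lambda>_. 0) \<le> 1 + N / n"
proof -
  have "peak (\<lambda>_. 0) \<le> 1"
  proof (rule peak_leI)
    fix i
    have "0 \<le> (\<Sum>j<Suc i - n. deficit 0) / real n"
      by (intro divide_nonneg_nonneg sum_nonneg deficit_nonneg) simp
    then show "piece i (\<lambda>_. 0) \<le> 1" using piece_le[of i "\<lambda>_. 0"] by linarith
  qed simp
  then show ?thesis by (simp add: hard_def deficit_def field_simps)
qed

section \<open>Lipschitz continuity and weak convexity of the hard function\<close>

text \<open>The 1-norm of the displacement is at most sqrt N <= n times its Euclidean norm L. A gate
  and a coordinate each change by at most L, the weighted sum by at most 2 L.\<close>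

lemma hard_le_hard:
  assumes Nn: "N \<le> n\<^sup>2"
  shows "hard x \<le> hard y + 4 * L2_set (\<lambda>i. x i - y i) {..<N}"
proof -
  define L where "L = L2_set (\<lambda>i. x i - y i) {..<N}"
  have "(\<Sum>j<N. \<bar>x j - y j\<bar>) = (\<Sum>j<N. \<bar>x j - y j\<bar> * \<bar>1\<bar>)" by simp
  also have "\<dots> \<le> L * L2_set (\<lambda>_. 1) {..<N}" unfolding L_def by (rule L2_set_mult_ineq)
  also have "\<dots> = L * sqrt N" by (simp add: L2_set_constant)
  also have "\<dots> \<le> L * n"
  proof -
    have "real N \<le> (real n)\<^sup>2" using Nn by (metis of_nat_le_iff of_nat_power)
    then have "sqrt N \<le> n" by (simp add: real_le_lsqrt)
    then show ?thesis by (intro mult_left_mono) (simp_all add: L_def)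
  qed
  finally have l1: "(\<Sum>j<N. \<bar>x j - y j\<bar>) \<le> L * n" .
  have dist: "deficit a - deficit b \<le> \<bar>a - b\<bar>" for a b
    using deficit_lipschitz[of a b] deficit_lipschitz[of b a] by linarith
  \<comment> \<open>Both orders occur: gates enter a piece with a minus sign, the outer sum with a
    plus sign.\<close>
  have part: "(\<Sum>j<k. deficit (a j)) - (\<Sum>j<k. deficit (b j)) \<le> L * n"
    if "k \<le> N" "a = x \<and> b = y \<or> a = y \<and> b = x" for k a b
  proof -
    have "(\<Sum>j<k. deficit (a j)) - (\<Sum>j<k. deficit (b j)) = (\<Sum>j<k. deficit (a j) - deficit (b j))"
      by (simp add: sum_subtractf)
    also have "\<dots> \<le> (\<Sum>j<k. \<bar>x j - y j\<bar>)"
      using that(2) dist by (intro sum_mono) (metis abs_minus_commute)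
    also have "\<dots> \<le> (\<Sum>j<N. \<bar>x j - y j\<bar>)" using that(1) by (intro sum_mono2) auto
    finally show ?thesis using l1 by linarith
  qed
  have "peak x \<le> peak y + 2 * L"
  proof (rule peak_leI)
    show "0 \<le> peak y + 2 * L" using peak_nonneg[of y] by (simp add: L_def)
  next
    fix i assume i: "i < N"
    let ?k = "Suc i - n"
    have "?k \<le> N" using i n_pos by simp
    then have "((\<Sum>j<?k. deficit (y j)) - (\<Sum>j<?k. deficit (x j))) / n \<le> L"
      using part[of ?k y x] n_pos by (simp add: field_simps)
    moreover have "\<bar>y i - x i\<bar> \<le> L"
    proof -
      have "\<bar>x i - y i\<bar> \<le> L2_set (\<lambda>i. \<bar>x i - y i\<bar>) {..<N}"
        using i by (intro member_le_L2_set) auto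
      then show ?thesis by (simp add: L_def L2_set_def abs_minus_commute)
    qed
    ultimately have "piece i x \<le> piece i y + 2 * L"
      by (simp add: piece_def diff_divide_distrib)
    then show "piece i x \<le> peak y + 2 * L" using piece_le_peak[OF i, of y] by linarith
  qed
  moreover have "2 / n * (\<Sum>j<N. deficit (x j)) \<le> 2 / n * (\<Sum>j<N. deficit (y j)) + 2 * L"
    using part[of N x y] n_pos by (simp add: field_simps)
  ultimately show ?thesis by (simp add: hard_def L_def)
qed

text \<open>Keeping only the term of the maximum that is active at x bounds \<open>hard\<close> from
  below. With the outer sum added, every deficit has net weight between 0 and 2/n, so its curvature
  costs at most (y i - x i)^2 / n.\<close>

lemma hard_weakly_convex:
  "\<exists>g. \<forall>y. hard x + (\<Sum>i<N. g i * (y i - x i)) - (\<Sum>i<N. (y i - x i)\<^sup>2) / n \<le> hard y"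
proof -
  obtain d where d: "\<And>a b. deficit a + d a * (b - a) - (b - a)\<^sup>2 / 2 \<le> deficit b"
    using deficit_weakly_convex by metis
  have weighted: "(\<Sum>j<N. c j * deficit (x j)) + (\<Sum>j<N. c j * d (x j) * (y j - x j))
      - (\<Sum>j<N. (y j - x j)\<^sup>2) / n \<le> (\<Sum>j<N. c j * deficit (y j))"
    if c: "\<And>j. 0 \<le> c j" "\<And>j. c j \<le> 2 / n" for c y
  proof -
    have "c j * deficit (x j) + c j * d (x j) * (y j - x j) - (y j - x j)\<^sup>2 / n
        \<le> c j * deficit (y j)" for j
    proof -
      have "c j * (deficit (x j) + d (x j) * (y j - x j) - (y j - x j)\<^sup>2 / 2) \<le> c j * deficit (y j)"
        using c(1) d by (rule mult_left_mono[rotated])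
      moreover have "c j * ((y j - x j)\<^sup>2 / 2) \<le> 2 / n * ((y j - x j)\<^sup>2 / 2)"
        using c(2) by (rule mult_right_mono) simp
      ultimately show ?thesis by (simp add: algebra_simps)
    qed
    then have "(\<Sum>j<N. c j * deficit (x j) + c j * d (x j) * (y j - x j) - (y j - x j)\<^sup>2 / n)
        \<le> (\<Sum>j<N. c j * deficit (y j))"
      by (intro sum_mono)
    then show ?thesis by (simp add: sum.distrib sum_subtractf sum_divide_distrib)
  qed
  show ?thesis
  proof (cases "peak x = 0")
    case True
    have "hard x + (\<Sum>j<N. 2 / n * d (x j) * (y j - x j)) - (\<Sum>j<N. (y j - x j)\<^sup>2) / n \<le> hard y" for y
      using weighted[of "\<lambda>_. 2 / n" y] peak_nonneg[of y] True
      by (simp add: hard_def sum_distrib_left)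
    then show ?thesis by (intro exI[of _ "\<lambda>j. 2 / n * d (x j)"] allI)
  next
    case False
    then obtain i where i: "i < N" "peak x = piece i x" using peak_cases by blast
    \<comment> \<open>Net weight: 2/n from the outer sum, less 1/n inside the gate of the active
      piece.\<close>
    define c where "c j = 2 / n - (if j < Suc i - n then 1 / n else 0)" for j
    have sub: "Suc i - n \<le> N" using i n_pos by simp
    have combine: "2 / n * (\<Sum>j<N. deficit (y j)) + piece i y
        = (\<Sum>j<N. c j * deficit (y j)) + (1 - i / (16 * N) - y i)" for y
    proof -
      have "(\<Sum>j<N. c j * deficit (y j)) = (\<Sum>j<N. 2 / n * deficit (y j)
          - (if j < Suc i - n then deficit (y j) / n else 0))"
        by (rule sum.cong) (auto simp: c_def algebra_simps)
      also have "\<dots> = 2 / n * (\<Sum>j<N. deficit (y j)) - (\<Sum>j<N. if j < Suc i - n then deficit (y j) / n else 0)"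
        by (simp add: sum_subtractf sum_distrib_left)
      also have "(\<Sum>j<N. if j < Suc i - n then deficit (y j) / n else 0) = (\<Sum>j<Suc i - n. deficit (y j) / n)"
        using sub by (intro sum.mono_neutral_cong_right) auto
      finally show ?thesis by (simp add: piece_def sum_divide_distrib)
    qed
    define g where "g j = c j * d (x j) - (if j = i then 1 else 0)" for j
    have "hard x + (\<Sum>j<N. g j * (y j - x j)) - (\<Sum>j<N. (y j - x j)\<^sup>2) / n \<le> hard y" for y
    proof -
      have "(\<Sum>j<N. g j * (y j - x j))
          = (\<Sum>j<N. c j * d (x j) * (y j - x j) - (if j = i then y j - x j else 0))"
        by (rule sum.cong) (auto simp: g_def algebra_simps)
      also have "\<dots> = (\<Sum>j<N. c j * d (x j) * (y j - x j)) - (y i - x i)"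
        using i by (simp add: sum_subtractf)
      finally have "(\<Sum>j<N. g j * (y j - x j)) = (\<Sum>j<N. c j * d (x j) * (y j - x j)) - (y i - x i)" .
      moreover have "(\<Sum>j<N. c j * deficit (x j)) + (\<Sum>j<N. c j * d (x j) * (y j - x j))
          - (\<Sum>j<N. (y j - x j)\<^sup>2) / n \<le> (\<Sum>j<N. c j * deficit (y j))"
        using n_pos by (intro weighted) (auto simp: c_def field_simps)
      ultimately show ?thesis
        using combine[of x] combine[of y] i piece_le_peak[OF i(1), of y] by (simp add: hard_def)
    qed
    then show ?thesis by (intro exI[of _ g] allI)
  qed
qed

section \<open>Locality of first-order information\<close>

text \<open>Piece k exceeds piece i by at least the tilt gap 1 / (16 N): both coordinates vanish,
  and the gate sum of i is at least that of k. A move within this gap cannot make piece i the new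
  maximum to first order, and all deficits change only quadratically.\<close>

lemma hard_perturb_unseen:
  assumes zero: "\<And>j. k \<le> j \<Longrightarrow> x j = 0" and i: "k < i" "i < N" and t: "\<bar>t\<bar> \<le> 1 / (16 * N)"
  shows "hard (x(i := t)) \<le> hard x + 2 * t\<^sup>2"
proof -
  have xi: "x i = 0" using zero i by simp
  have step: "\<bar>deficit ((x(i := t)) j) - deficit (x j)\<bar> \<le> (if j = i then t\<^sup>2 / 2 else 0)" for j
    using deficit_near_zero[of t] xi by simp
  have part: "\<bar>(\<Sum>j<m. deficit ((x(i := t)) j)) - (\<Sum>j<m. deficit (x j))\<bar> \<le> t\<^sup>2 / 2" for m
  proof -
    have "\<bar>\<Sum>j<m. deficit ((x(i := t)) j) - deficit (x j)\<bar> \<le> (\<Sum>j<m. if j = i then t\<^sup>2 / 2 else 0)"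
      using step by (rule order_trans[OF sum_abs sum_mono])
    also have "\<dots> \<le> t\<^sup>2 / 2" by simp
    finally show ?thesis by (simp only: sum_subtractf)
  qed
  have part_n: "\<bar>(\<Sum>j<m. deficit ((x(i := t)) j)) / n - (\<Sum>j<m. deficit (x j)) / n\<bar> \<le> t\<^sup>2 / 2" for m
  proof -
    let ?D = "(\<Sum>j<m. deficit ((x(i := t)) j)) - (\<Sum>j<m. deficit (x j))"
    have "\<bar>?D / n\<bar> \<le> \<bar>?D\<bar> / 1"
      unfolding abs_divide using n_pos by (intro divide_left_mono) auto
    from order_trans[OF this[unfolded div_by_1] part] show ?thesis
      by (simp only: diff_divide_distrib)
  qed
  note part_n' = abs_le_D2[OF part_n] abs_le_D1[OF part_n]
  have "peak (x(i := t)) \<le> peak x + t\<^sup>2 / 2"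
  proof (rule peak_leI)
    show "0 \<le> peak x + t\<^sup>2 / 2" using peak_nonneg[of x] by simp
  next
    fix l assume l: "l < N"
    show "piece l (x(i := t)) \<le> peak x + t\<^sup>2 / 2"
    proof (cases "l = i")
      case False
      then have "(x(i := t)) l = x l" by simp
      then have "piece l (x(i := t)) \<le> piece l x + t\<^sup>2 / 2"
        using part_n'(1)[of "Suc l - n"] unfolding piece_def by linarith
      then show ?thesis using piece_le_peak[OF l, of x] by linarith
    next
      case True
      have "(\<Sum>j<Suc k - n. deficit (x j)) \<le> (\<Sum>j<Suc i - n. deficit (x j))"
        using i by (intro sum_mono2) (auto simp: deficit_nonneg)
      then have "(\<Sum>j<Suc k - n. deficit (x j)) / n \<le> (\<Sum>j<Suc i - n. deficit (x j)) / n"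
        by (rule divide_right_mono) simp
      moreover have "k / (16 * N) + 1 / (16 * N) \<le> i / (16 * N)"
        using i(1) unfolding add_divide_distrib[symmetric] by (intro divide_right_mono) auto
      moreover have "x k = 0" using zero by simp
      ultimately have "piece i (x(i := t)) \<le> piece k x + t\<^sup>2 / 2"
        using part_n'(1)[of "Suc i - n"] abs_le_D2[OF t] xi unfolding piece_def fun_upd_same by linarith
      then show ?thesis using piece_le_peak[of k x] i True by simp
    qed
  qed
  moreover have "2 / n * (\<Sum>j<N. deficit ((x(i := t)) j)) \<le> 2 / n * (\<Sum>j<N. deficit (x j)) + t\<^sup>2"
    using part_n'(2)[of N] by (simp add: mult.commute del: fun_upd_apply)
  moreover have "0 \<le> t\<^sup>2" by simp
  ultimately show ?thesis unfolding hard_def by linarith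
qed

section \<open>Descent directions for the hard function\<close>

text \<open>The weight \<open>2/n\<close> in \<^const>\<open>hard\<close> pays twice for any opening of the gates in \<^const>\<open>piece\<close>.\<close>

lemma hard_raise:
  assumes w: "\<And>j. 0 \<le> w j" and c: "0 \<le> c" and le: "\<And>i. i < N \<Longrightarrow> piece i z - w i \<le> c"
  shows "hard (\<lambda>j. z j + w j)
    \<le> c + 2 / n * (\<Sum>j<N. deficit (z j)) - (\<Sum>j<N. deficit (z j) - deficit (z j + w j)) / n"
proof -
  define H where "H = (\<Sum>j<N. deficit (z j) - deficit (z j + w j)) / n"
  have drop: "0 \<le> deficit (z j) - deficit (z j + w j)" for j
    using deficit_lipschitz(1)[of "z j" "z j + w j"] w[of j] by simp
  have H0: "0 \<le> H" unfolding H_def by (intro divide_nonneg_nonneg sum_nonneg drop) simp_all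
  have "peak (\<lambda>j. z j + w j) \<le> c + H"
  proof (rule peak_leI)
    show "0 \<le> c + H" using c H0 by simp
  next
    fix i assume i: "i < N"
    have "(\<Sum>j<Suc i - n. deficit (z j) - deficit (z j + w j)) \<le> (\<Sum>j<N. deficit (z j) - deficit (z j + w j))"
      using i n_pos by (intro sum_mono2) (auto simp: drop[simplified])
    then have "(\<Sum>j<Suc i - n. deficit (z j) - deficit (z j + w j)) / n \<le> H"
      unfolding H_def by (rule divide_right_mono) simp
    then have "piece i (\<lambda>j. z j + w j) \<le> piece i z - w i + H"
      by (simp add: piece_def sum_subtractf diff_divide_distrib)
    then show "piece i (\<lambda>j. z j + w j) \<le> c + H" using le[OF i] by linarith
  qed
  moreover have "2 / n * (\<Sum>j<N. deficit (z j + w j)) = 2 / n * (\<Sum>j<N. deficit (z j)) - 2 * H"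
    by (simp add: H_def sum_subtractf right_diff_distrib diff_divide_distrib)
  ultimately show ?thesis unfolding hard_def H_def[symmetric] by linarith
qed

text \<open>
  Either many coordinates sit where \<^const>\<open>deficit\<close> is steep, and raising them along
  \<^const>\<open>slack\<close> suffices, or the maximum is bounded below and has at most \<open>4n\<close> nearly active
  indices, which are then raised together.
\<close>

lemma hard_descent:
  assumes sum_z: "real n / 8 < (\<Sum>j<N. deficit (z j))"
  shows "\<exists>v. (\<forall>j. 0 \<le> v j \<and> v j \<le> 1) \<and> (\<forall>j\<ge>N. v j = 0) \<and>
    1 / (64 * sqrt N) \<le> L2_set v {..<N} \<and>
    (\<forall>t. 0 \<le> t \<and> t \<le> 1 / 16 \<longrightarrow>
      hard (\<lambda>j. z j + t * v j) \<le> hard z - t * L2_set v {..<N} / (64 * sqrt n))"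
\<comment> \<open>Since 6 * n / 64 < n / 8, below this threshold the deficit cannot come from
  coordinates above 1/4 alone.\<close>
proof (cases "real n / 64 \<le> (\<Sum>j<N. slack (z j))")
  case True
  define R where "R = (\<Sum>j<N. slack (z j))"
  define v where "v j = (if j < N then slack (z j) else 0)" for j
  define L where "L = L2_set v {..<N}"
  have R: "real n / 64 \<le> R" "0 < R" using True n_pos by (auto simp: R_def)
  have v_le: "0 \<le> v j" "v j \<le> 1" for j using slack_bounds[of "z j"] by (simp_all add: v_def)
  have v_sum: "(\<Sum>j<N. v j) = R" by (simp add: R_def v_def)
  have L_sq: "L\<^sup>2 = (\<Sum>j<N. (v j)\<^sup>2)" by (simp add: L_def L2_set_def sum_nonneg)
  have "L\<^sup>2 \<le> R"
    unfolding L_sq v_sum[symmetric]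
  proof (rule sum_mono)
    fix j
    show "(v j)\<^sup>2 \<le> v j"
      using v_le[of j] by (simp add: power2_eq_square mult_left_le)
  qed
  then have L_le: "L \<le> sqrt R" using real_le_rsqrt by blast
  have R_sq: "R\<^sup>2 \<le> L\<^sup>2 * N"
    unfolding L_sq using sum_squared_le_sum_of_squares[of v "{..<N}"] by (simp add: v_sum)
  \<comment> \<open>This bound is independent of z and later yields the uniform step length
    \<open>\<tau>\<close> of \<open>not_stationaryI\<close>.\<close>
  have "1 / (64 * sqrt N) \<le> L"
  proof -
    have "1 / 64 \<le> R" using R(1) n_pos by simp
    moreover have "R \<le> L * sqrt N"
      using real_sqrt_le_mono[OF R_sq] R(2) by (simp add: real_sqrt_mult L_def)
    ultimately show ?thesis using N_pos by (simp add: field_simps)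
  qed
  moreover have "hard (\<lambda>j. z j + t * v j) \<le> hard z - t * L / (64 * sqrt n)"
    if t: "0 \<le> t" "t \<le> 1 / 16" for t
  proof -
    have "hard (\<lambda>j. z j + t * v j) \<le> peak z + 2 / n * (\<Sum>j<N. deficit (z j))
        - (\<Sum>j<N. deficit (z j) - deficit (z j + t * v j)) / n"
    proof (rule hard_raise)
      show pos: "0 \<le> t * v j" for j using t v_le by simp
      show "piece i z - t * v i \<le> peak z" if "i < N" for i
        using piece_le_peak[OF that, of z] pos[of i] by linarith
    qed (rule peak_nonneg)
    moreover have "t * R / 8 \<le> (\<Sum>j<N. deficit (z j) - deficit (z j + t * v j))"
      unfolding R_def sum_distrib_left sum_divide_distrib
      using t deficit_decrease by (intro sum_mono) (simp add: v_def)
    then have "t * R / 8 / n \<le> (\<Sum>j<N. deficit (z j) - deficit (z j + t * v j)) / n"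
      by (rule divide_right_mono) simp
    \<comment> \<open>\<open>R\<close> is at least n / 64, so sqrt n <= 8 sqrt R; with L <= sqrt R
      this gives L sqrt n <= 8 R.\<close>
    moreover have "t * L / (64 * sqrt n) \<le> t * R / 8 / n"
    proof -
      have "sqrt n / 8 \<le> sqrt R"
        using real_sqrt_le_mono[OF R(1)] by (simp add: real_sqrt_divide)
      then have "L * sqrt n \<le> sqrt R * (8 * sqrt R)"
        using L_le R(2) by (intro mult_mono) (auto simp: L_def)
      also have "\<dots> = 8 * R" using R(2) by simp
      finally have "L * sqrt n / (64 * n) \<le> 8 * R / (64 * n)" by (rule divide_right_mono) simp
      moreover have "L * sqrt n / (64 * n) = L / (64 * sqrt n)"
      proof -
        have "L * sqrt n * (64 * sqrt n) = L * 64 * (sqrt n * sqrt n)" by (simp only: mult_ac)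
        then have "L * sqrt n * (64 * sqrt n) = L * (64 * n)" by simp
        then show ?thesis using n_pos by (subst frac_eq_eq) auto
      qed
      ultimately have "t * (L / (64 * sqrt n)) \<le> t * (8 * R / (64 * n))"
        using t by (intro mult_left_mono) auto
      then show ?thesis by simp
    qed
    ultimately show ?thesis by (simp add: hard_def)
  qed
  ultimately show ?thesis
    unfolding L_def by (intro exI[of _ v]) (auto simp: v_le, simp add: v_def)
next
  case False
  define W where "W k = (\<Sum>j<k. deficit (z j))" for k
  have W_mono: "W k \<le> W l" if "k \<le> l" for k l
    unfolding W_def using that by (intro sum_mono2) (auto simp: deficit_nonneg)
  \<comment> \<open>Up to index b the gates are closed by at most 1/8. Some coordinate there is
    below 1/4, and the tilt is at most 1/16, so its piece is at least 9/16.\<close>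
  define b where "b = (LEAST b. real n / 8 < W (Suc b))"
  have ex: "real n / 8 < W (Suc (N - 1))" using sum_z N_pos by (simp add: W_def)
  then have b: "real n / 8 < W (Suc b)" "b \<le> N - 1"
    unfolding b_def by (rule LeastI, rule Least_le)
  have W_b: "W k \<le> n / 8" if "k \<le> b" for k
  proof (cases k)
    case (Suc l)
    then show ?thesis using not_less_Least[of l "\<lambda>b. real n / 8 < W (Suc b)"] that by (simp add: b_def)
  qed (simp add: W_def)
  have "\<exists>i\<le>b. z i < 1 / 4"
  proof (rule ccontr)
    assume "\<not> ?thesis"
    then have "W (Suc b) \<le> (\<Sum>j<Suc b. 6 * slack (z j))"
      unfolding W_def by (intro sum_mono deficit_le_slack) (auto simp: not_less less_Suc_eq_le)
    also have "\<dots> \<le> (\<Sum>j<N. 6 * slack (z j))"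
      using b(2) N_pos slack_bounds by (intro sum_mono2) auto
    also have "\<dots> \<le> 6 * (n / 64)" using False by (simp add: sum_distrib_left[symmetric])
    finally show False using b(1) n_pos by simp
  qed
  then obtain i where i: "i \<le> b" "z i < 1 / 4" by blast
  then have iN: "i < N" using b(2) N_pos by simp
  have "9 / 16 \<le> piece i z"
  proof -
    have "W (Suc i - n) / n \<le> 1 / 8" using W_b[of "Suc i - n"] i n_pos by (simp add: field_simps)
    moreover have "i / (16 * N) \<le> 1 / 16" using iN by (simp add: field_simps)
    ultimately show ?thesis using i by (simp add: piece_def W_def)
  qed
  then have peak_z: "9 / 16 \<le> peak z" using piece_le_peak[OF iN, of z] by simp
  \<comment> \<open>The margin equals the largest step, so pieces outside \<open>V\<close> stay at
    or below the lowered level \<open>peak z - t\<close>. Pieces in \<open>V\<close> are at least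
    9/16 - 1/16 = 1/2.\<close>
  define V where "V = {i. i < N \<and> peak z - 1 / 16 \<le> piece i z}"
  have fin: "finite V" by (simp add: V_def)
  have V_W: "W (Suc i - n) / n \<le> 1 / 2 - z i" if "i \<in> V" for i
    using that peak_z piece_le[of i z] by (simp add: V_def W_def)
  define Vneg where "Vneg = {i \<in> V. z i \<le> - (1 / 4)}"
  define Vpos where "Vpos = {i \<in> V. - (1 / 4) < z i}"
  have V_split: "V = Vneg \<union> Vpos" "Vneg \<subseteq> {..<N}" "Vpos \<subseteq> {..<N}" "finite Vneg" "finite Vpos"
    using fin by (auto simp: Vneg_def Vpos_def V_def)
  \<comment> \<open>Each index carries slack 1/8, while the total slack is below n / 64.\<close>
  have "card Vneg \<le> n"
  proof -
    have "real (card Vneg) / 8 = (\<Sum>j\<in>Vneg. slack (z j))" by (simp add: Vneg_def slack_def)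
    also have "\<dots> \<le> (\<Sum>j<N. slack (z j))"
      using V_split slack_bounds by (intro sum_mono2) auto
    finally show ?thesis using False by simp
  qed
  \<comment> \<open>Each index has z at most 1/2, hence deficit at least 3/8. The gate of the last
    one bounds the total deficit inside it by (1/2 + 1/4) n, which admits 2 n such indices; the
    others lie in a window of n.\<close>
  moreover have "card Vpos \<le> 3 * n"
  proof (cases "Vpos = {}")
    case nonempty: False
    define top where "top = Max Vpos"
    have top: "top \<in> Vpos" using nonempty V_split by (simp add: top_def)
    define early where "early = {j \<in> Vpos. j < Suc top - n}"
    have low: "3 / 8 \<le> deficit (z j)" if "j \<in> Vpos" for j
    proof -
      have "0 \<le> W (Suc j - n) / n" by (simp add: W_def sum_nonneg deficit_nonneg)
      then have "z j \<le> 1 / 2" using V_W[of j] that by (simp add: Vpos_def)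
      then have "deficit (1 / 2) \<le> deficit (z j)" by (rule deficit_lipschitz)
      then show ?thesis by (simp add: deficit_def power2_eq_square)
    qed
    have "3 / 8 * card early = (\<Sum>j\<in>early. 3 / 8)" by simp
    also have "\<dots> \<le> (\<Sum>j\<in>early. deficit (z j))" by (intro sum_mono low) (simp add: early_def)
    also have "\<dots> \<le> W (Suc top - n)"
      unfolding W_def by (intro sum_mono2) (auto simp: early_def deficit_nonneg)
    also have "\<dots> \<le> 3 / 4 * n"
    proof -
      have "W (Suc top - n) / n \<le> 3 / 4" using V_W[of top] top unfolding Vpos_def mem_Collect_eq by linarith
      then show ?thesis using n_pos by (simp add: divide_le_eq)
    qed
    finally have "real (card early) \<le> 2 * real n" by simp
    then have "card early \<le> 2 * n" by linarith
    moreover have "Vpos \<subseteq> early \<union> {Suc top - n..top}"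
      using V_split by (auto simp: early_def top_def not_less)
    then have "card Vpos \<le> card (early \<union> {Suc top - n..top})"
      using V_split by (intro card_mono) (auto simp: early_def)
    then have "card Vpos \<le> card early + card {Suc top - n..top}"
      using card_Un_le order_trans by blast
    ultimately show ?thesis by simp
  qed simp
  ultimately have "card V \<le> 4 * n"
    unfolding V_split(1) using card_Un_le[of Vneg Vpos] by linarith
  define v where "v j = (if j \<in> V then 1 else 0 :: real)" for j
  define L where "L = L2_set v {..<N}"
  have "(\<Sum>j<N. (v j)\<^sup>2) = (\<Sum>j\<in>V. 1)"
    by (rule sum.mono_neutral_cong_right) (auto simp: v_def V_def)
  then have L_eq: "L = sqrt (card V)" by (simp add: L_def L2_set_def)
  have "V \<noteq> {}"
  proof -
    obtain k where "k < N" "peak z = piece k z" using peak_cases[of z] peak_z by force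
    then show ?thesis by (auto simp: V_def)
  qed
  then have L1: "1 \<le> L" using fin by (simp add: L_eq Suc_leI card_gt_0_iff)
  have L2: "L \<le> 2 * sqrt n"
  proof -
    have "sqrt (card V) \<le> sqrt (4 * n)" using \<open>card V \<le> 4 * n\<close> by (metis of_nat_le_iff real_sqrt_le_mono)
    then show ?thesis by (simp add: L_eq real_sqrt_mult)
  qed
  have "hard (\<lambda>j. z j + t * v j) \<le> hard z - t * L / (64 * sqrt n)"
    if t: "0 \<le> t" "t \<le> 1 / 16" for t
  proof -
    have "hard (\<lambda>j. z j + t * v j) \<le> (peak z - t) + 2 / n * (\<Sum>j<N. deficit (z j))
        - (\<Sum>j<N. deficit (z j) - deficit (z j + t * v j)) / n"
    proof (rule hard_raise)
      show "0 \<le> t * v j" for j using t by (simp add: v_def)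
      show "piece i z - t * v i \<le> peak z - t" if "i < N" for i
        using piece_le_peak[OF that, of z] that t by (auto simp: v_def V_def)
      show "0 \<le> peak z - t" using peak_z t by simp
    qed
    moreover have "0 \<le> (\<Sum>j<N. deficit (z j) - deficit (z j + t * v j)) / n"
      using t by (intro divide_nonneg_nonneg sum_nonneg) (auto simp: v_def intro!: deficit_lipschitz)
    moreover have "t * L / (64 * sqrt n) \<le> t"
    proof -
      have "L \<le> 64 * sqrt n" using L2 real_sqrt_ge_zero[of "real n"] by linarith
      then have "L / (64 * sqrt n) \<le> 1" using n_pos by (simp add: divide_le_eq)
      then show ?thesis using mult_left_mono[OF _ t(1), of "L / (64 * sqrt n)" 1] by simp
    qed
    ultimately show ?thesis by (simp add: hard_def)
  qed
  moreover have "1 / (64 * sqrt N) \<le> L"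
  proof -
    have "1 \<le> sqrt N" using N_pos by simp
    then have "1 \<le> 64 * sqrt N" by linarith
    then have "1 / (64 * sqrt N) \<le> 1" using divide_le_eq_1_pos[of "64 * sqrt N" 1] by linarith
    then show ?thesis using L1 by simp
  qed
  ultimately show ?thesis
    unfolding L_def by (intro exI[of _ v]) (auto simp: v_def V_def)
qed

text \<open>Lifting an untouched coordinate above 1/2 costs squared distance 1/4, so at most n / 2
  of the last n are lifted. The others keep deficit 3/8 each, in total at least 3 n / 16.\<close>

lemma deficit_sum_gt:
  assumes "n \<le> N" and x: "\<And>j. N - n \<le> j \<Longrightarrow> x j = 0"
    and dist: "(\<Sum>j<N. (z j - x j)\<^sup>2) \<le> n / 8"
  shows "real n / 8 < (\<Sum>j<N. deficit (z j))"
proof -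
  define far where "far = {j \<in> {N - n..<N}. 1 / 2 < z j}"
  have sub: "far \<subseteq> {N - n..<N}" by (auto simp: far_def)
  have "card far / 4 = (\<Sum>j\<in>far. 1 / 4)" by simp
  also have "\<dots> \<le> (\<Sum>j\<in>far. (z j - x j)\<^sup>2)"
  proof (rule sum_mono)
    fix j assume "j \<in> far"
    then have "(1 / 2)\<^sup>2 \<le> (z j - x j)\<^sup>2" by (intro power_mono) (auto simp: far_def x)
    then show "1 / 4 \<le> (z j - x j)\<^sup>2" by (simp add: power2_eq_square)
  qed
  also have "\<dots> \<le> (\<Sum>j<N. (z j - x j)\<^sup>2)" by (intro sum_mono2) (auto simp: far_def)
  finally have far: "real (card far) \<le> n / 2" using dist by simp
  let ?near = "{N - n..<N} - far"
  have "card ?near = n - card far"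
    using sub assms(1) by (subst card_Diff_subset) (auto intro: finite_subset)
  then have "n / 2 \<le> real (card ?near)" using far by linarith
  then have "n / 8 < 3 / 8 * real (card ?near)" using n_pos by simp
  also have "\<dots> = (\<Sum>j\<in>?near. 3 / 8)" by simp
  also have "\<dots> \<le> (\<Sum>j\<in>?near. deficit (z j))"
  proof (rule sum_mono)
    fix j assume "j \<in> ?near"
    then have "deficit (1 / 2) \<le> deficit (z j)" by (intro deficit_lipschitz) (auto simp: far_def)
    then show "3 / 8 \<le> deficit (z j)" by (simp add: deficit_def power2_eq_square)
  qed
  also have "\<dots> \<le> (\<Sum>j<N. deficit (z j))"
    by (intro sum_mono2) (auto simp: deficit_nonneg)
  finally show ?thesis .
qed

end

section \<open>Weakly convex functions on \<open>\<real>\<^sup>d\<close>\<close>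

lemma convex_Rd: "convex (Rd d)"
  unfolding convex_def Rd_def supp_def by (force simp: subset_iff)

lemma Rd_zero [simp]: "0 \<in> Rd d"
  and Rd_add: "x \<in> Rd d \<Longrightarrow> y \<in> Rd d \<Longrightarrow> x + y \<in> Rd d"
  and Rd_diff: "x \<in> Rd d \<Longrightarrow> y \<in> Rd d \<Longrightarrow> x - y \<in> Rd d"
  and Rd_scaleR: "x \<in> Rd d \<Longrightarrow> r *\<^sub>R x \<in> Rd d"
  unfolding Rd_def supp_def by (force simp: subset_iff)+

lemma inner_Rd: "x \<in> Rd d \<Longrightarrow> inner x y = (\<Sum>i<d. coord x i * coord y i)"
  unfolding inner_fseq_def Rd_def by (intro sum_supp_superset) auto

lemma norm_Rd: "x \<in> Rd d \<Longrightarrow> norm x = L2_set (coord x) {..<d}"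
  by (simp add: norm_fseq_def inner_Rd L2_set_def power2_eq_square)

definition vec_of :: "nat \<Rightarrow> (nat \<Rightarrow> real) \<Rightarrow> fseq" where
  "vec_of d u = Abs_fseq (\<lambda>i. if i < d then u i else 0)"

lemma coord_vec_of: "coord (vec_of d u) i = (if i < d then u i else 0)"
proof -
  have "finite {i. (if i < d then u i else 0) \<noteq> 0}"
    by (rule finite_subset[of _ "{..<d}"]) auto
  then show ?thesis unfolding vec_of_def by (subst Abs_fseq_inverse) auto
qed

lemma vec_of_Rd: "vec_of d u \<in> Rd d"
  by (auto simp: Rd_def supp_def coord_vec_of split: if_splits)

lemma convex_on_subgradientI:
  assumes "convex S" and sub: "\<And>x. x \<in> S \<Longrightarrow> \<exists>g. \<forall>y\<in>S. h x + inner g (y - x) \<le> h y"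
  shows "convex_on S h"
proof (rule convex_onI)
  fix t :: real and x y assume t: "0 < t" "t < 1" and xy: "x \<in> S" "y \<in> S"
  define z where "z = (1 - t) *\<^sub>R x + t *\<^sub>R y"
  have "z \<in> S" unfolding z_def using assms(1) xy t by (intro convexD) auto
  then obtain g where g: "\<And>w. w \<in> S \<Longrightarrow> h z + inner g (w - z) \<le> h w" using sub by blast
  have "(1 - t) * (h z + inner g (x - z)) + t * (h z + inner g (y - z)) \<le> (1 - t) * h x + t * h y"
    using g[OF xy(1)] g[OF xy(2)] t by (intro add_mono mult_left_mono) auto
  moreover have "(1 - t) * (h z + inner g (x - z)) + t * (h z + inner g (y - z))
      = h z + inner g ((1 - t) *\<^sub>R (x - z) + t *\<^sub>R (y - z))"
    by (simp add: inner_add_right algebra_simps)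
  moreover have "(1 - t) *\<^sub>R (x - z) + t *\<^sub>R (y - z) = 0"
    unfolding z_def by (simp add: algebra_simps)
  ultimately show "h ((1 - t) *\<^sub>R x + t *\<^sub>R y) \<le> (1 - t) * h x + t * h y"
    by (simp add: z_def)
qed fact

lemma weakly_convex_withI:
  assumes "\<And>x. x \<in> Rd d \<Longrightarrow>
    \<exists>g. \<forall>y\<in>Rd d. f x + inner g (y - x) - \<rho> / 2 * (norm (y - x))\<^sup>2 \<le> f y"
  shows "weakly_convex_with \<rho> d f"
  unfolding weakly_convex_with_def
proof (rule convex_on_subgradientI[OF convex_Rd])
  fix x assume "x \<in> Rd d"
  then obtain g where g: "\<And>y. y \<in> Rd d \<Longrightarrow>
    f x + inner g (y - x) - \<rho> / 2 * (norm (y - x))\<^sup>2 \<le> f y" using assms by blast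
  have "f x + \<rho> / 2 * (norm x)\<^sup>2 + inner (g + \<rho> *\<^sub>R x) (y - x) \<le> f y + \<rho> / 2 * (norm y)\<^sup>2"
    if "y \<in> Rd d" for y
  proof -
    have "\<rho> / 2 * (norm y)\<^sup>2 = \<rho> / 2 * (norm x)\<^sup>2 + \<rho> * inner x (y - x) + \<rho> / 2 * (norm (y - x))\<^sup>2"
      unfolding power2_norm_eq_inner by (simp add: inner_diff_left inner_diff_right inner_commute algebra_simps)
    then show ?thesis using g[OF that] unfolding inner_add_left inner_scaleR_left by linarith
  qed
  then show "\<exists>g. \<forall>y\<in>Rd d. f x + \<rho> / 2 * (norm x)\<^sup>2 + inner g (y - x) \<le> f y + \<rho> / 2 * (norm y)\<^sup>2"
    by blast
qed

text \<open>A nonzero component along e would force linear growth in the direction of its sign,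
  against the quadratic upper bound. The bound is assumed for both signs of t because that sign is
  unknown.\<close>

lemma subdifferential_coord_eq_0:
  assumes g: "g \<in> subdifferential d f x" and x: "x \<in> Rd d" and e: "e \<in> Rd d" "norm e = 1"
    and r: "0 < r"
    and quad: "\<And>t. \<bar>t\<bar> \<le> r \<Longrightarrow> f (x + t *\<^sub>R e) \<le> f x + C * t\<^sup>2"
  shows "inner g e = 0"
proof (rule ccontr)
  assume ne: "inner g e \<noteq> 0"
  define a where "a = \<bar>inner g e\<bar> / 2"
  have a: "0 < a" using ne by (simp add: a_def)
  have "0 \<le> Liminf (at x within Rd d) (\<lambda>y. ereal ((f y - f x - inner g (y - x)) / norm (y - x)))"
    using g by (simp add: subdifferential_def)
  then have "\<forall>\<^sub>F y in at x within Rd d. ereal (- a) < ereal ((f y - f x - inner g (y - x)) / norm (y - x))"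
    unfolding le_Liminf_iff by (rule allE[of _ "ereal (- a)"]) (use a in simp)
  then obtain \<delta> where \<delta>: "0 < \<delta>" and lower: "\<And>y. y \<in> Rd d \<Longrightarrow> y \<noteq> x \<Longrightarrow> dist y x < \<delta> \<Longrightarrow>
      - a < (f y - f x - inner g (y - x)) / norm (y - x)"
    unfolding eventually_at by auto
  \<comment> \<open>The last bound keeps the quadratic term below half of the linear term 2 a
    t.\<close>
  define t where "t = min (min r (\<delta> / 2)) (a / (\<bar>C\<bar> + 1))"
  have t: "0 < t" "t \<le> r" "t < \<delta>" "t \<le> a / (\<bar>C\<bar> + 1)"
    unfolding t_def using r \<delta> a by (auto intro!: divide_pos_pos add_nonneg_pos)
  then have tC: "t * (\<bar>C\<bar> + 1) \<le> a" by (simp add: pos_le_divide_eq add_nonneg_pos)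
  define s where "s = sgn (inner g e) * t"
  have s: "\<bar>s\<bar> = t" "s * inner g e = 2 * a * t" "s\<^sup>2 = t * t"
    using t ne by (auto simp: s_def a_def abs_mult power_mult_distrib power2_eq_square sgn_if)
  let ?y = "x + s *\<^sub>R e"
  have "- a < (f ?y - f x - inner g (?y - x)) / norm (?y - x)"
  proof (rule lower)
    show "?y \<in> Rd d" by (intro Rd_add Rd_scaleR x e)
    show "?y \<noteq> x" using s t e by auto
    show "dist ?y x < \<delta>" using s t e by (simp add: dist_norm)
  qed
  also have "\<dots> = (f ?y - f x - 2 * a * t) / t" using s e by simp
  also have "\<dots> \<le> (C * t\<^sup>2 - 2 * a * t) / t"
    using quad[of s] s t by (intro divide_right_mono) (auto simp: power2_eq_square)
  also have "\<dots> = C * t - 2 * a" using t by (simp add: field_simps power2_eq_square)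
  also have "\<dots> \<le> t * (\<bar>C\<bar> + 1) - 2 * a"
  proof -
    have "C * t \<le> (\<bar>C\<bar> + 1) * t" using t by (intro mult_right_mono) auto
    then show ?thesis by (simp add: mult.commute)
  qed
  finally show False using tC by simp
qed

text \<open>
  An approximate minimiser \<open>z\<close> of the problem defining the envelope at \<open>x\<close> satisfies
  \<open>\<nabla>f\<^bsub>1/(2\<rho>)\<^esub>(x) \<approx> 2\<rho>(x - z)\<close>, so stationarity puts \<open>z\<close> near \<open>x\<close>; a descent step at \<open>z\<close> would then
  beat the minimum. The uniform lower bound \<open>\<tau>\<close> on the step replaces attainment of the minimum.
\<close>

lemma not_stationaryI:
  assumes pos: "0 < \<rho>" "0 < \<epsilon>" "0 < \<tau>" and bdd: "\<And>z. z \<in> Rd d \<Longrightarrow> B \<le> f z" and x: "x \<in> Rd d"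
    and desc: "\<And>z. z \<in> Rd d \<Longrightarrow> norm (z - x) \<le> \<epsilon> / \<rho> \<Longrightarrow>
      \<exists>w\<in>Rd d. \<tau> \<le> norm w \<and> norm w \<le> \<epsilon> / \<rho> \<and> f (z + w) \<le> f z - 4 * \<epsilon> * norm w"
  shows "\<not> stationary d \<rho> \<epsilon> f x"
proof
  assume "stationary d \<rho> \<epsilon> f x"
  then obtain g where g: "g \<in> Rd d" "(moreau_envelope d \<rho> f has_derivative inner g) (at x within Rd d)"
    "norm g \<le> \<epsilon>"
    unfolding stationary_def has_gradient_def by blast
  define h where "h = moreau_envelope d \<rho> f"
  have bdd_below: "bdd_below ((\<lambda>z. f z + \<rho> * (norm (y - z))\<^sup>2) ` Rd d)" for y
    using bdd pos by (intro bdd_belowI2[of _ B]) (simp add: add_increasing2)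
  have h_le: "h y \<le> f z + \<rho> * (norm (y - z))\<^sup>2" if "z \<in> Rd d" for y z
    unfolding h_def moreau_envelope_def using that by (intro cINF_lower bdd_below)
  have near: "\<exists>z\<in>Rd d. f z + \<rho> * (norm (x - z))\<^sup>2 < h x + \<eta>" if "0 < \<eta>" for \<eta>
  proof -
    have "(INF z\<in>Rd d. f z + \<rho> * (norm (x - z))\<^sup>2) < h x + \<eta>"
      using that by (simp add: h_def moreau_envelope_def)
    then show ?thesis using cINF_less_iff[OF _ bdd_below[of x]] Rd_zero by blast
  qed
  have "\<exists>\<delta>>0. \<forall>y\<in>Rd d. norm (y - x) < \<delta> \<longrightarrow>
      norm (h y - h x - inner g (y - x)) \<le> \<epsilon> / 4 * norm (y - x)"
    using g(2) pos(2) unfolding h_def has_derivative_within_alt by (metis zero_less_divide_iff zero_less_numeral)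
  then obtain \<delta> where \<delta>: "0 < \<delta>" and lin: "\<And>y. y \<in> Rd d \<Longrightarrow> norm (y - x) < \<delta> \<Longrightarrow>
      norm (h y - h x - inner g (y - x)) \<le> \<epsilon> / 4 * norm (y - x)" by blast
  \<comment> \<open>Short enough for the linearisation of the envelope, and for \<rho> r^2 <=
    \<epsilon> r / 4.\<close>
  define r where "r = min (\<delta> / 2) (\<epsilon> / (4 * \<rho>))"
  have r: "0 < r" "r < \<delta>" "\<rho> * r \<le> \<epsilon> / 4" using \<delta> pos by (auto simp: r_def min_def field_simps)
  \<comment> \<open>The first bound serves the estimate of \<open>D\<close>, the second the final
    contradiction.\<close>
  define \<eta> where "\<eta> = min (\<epsilon> * r / 4) (\<epsilon> * \<tau>)"
  have \<eta>: "0 < \<eta>" "\<eta> \<le> \<epsilon> * r / 4" "\<eta> \<le> \<epsilon> * \<tau>" using r pos by (auto simp: \<eta>_def)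
  obtain z where z: "z \<in> Rd d" "f z + \<rho> * (norm (x - z))\<^sup>2 < h x + \<eta>" using near \<eta> by blast
  have expand: "(norm (p + q))\<^sup>2 = (norm p)\<^sup>2 + 2 * inner p q + (norm q)\<^sup>2" for p q :: fseq
    by (simp add: power2_norm_eq_inner inner_add_left inner_add_right inner_commute)
  define D where "D = norm (x - z)"
  have D: "D \<le> \<epsilon> / \<rho>"
  proof (cases "D = 0")
    case False
    \<comment> \<open>A step of length r from x towards z lowers the quadratic penalty by about 2
      \<rho> r D, whereas the envelope can drop by little more than \<epsilon> r. The errors add up
      to less than 2 \<epsilon> r.\<close>
    define u where "u = (- (r / D)) *\<^sub>R (x - z)"
    have u: "norm u = r" "inner (x - z) u = - r * D" "u \<in> Rd d"
      using False r Rd_scaleR[OF Rd_diff[OF x z(1)]]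
      by (simp_all add: u_def D_def dot_square_norm power2_eq_square del: scaleR_minus_left)
    have "h (x + u) \<le> f z + \<rho> * (norm ((x - z) + u))\<^sup>2"
      using h_le[OF z(1), of "x + u"] by (simp add: algebra_simps)
    also have "\<dots> = f z + \<rho> * (norm (x - z))\<^sup>2 - 2 * \<rho> * r * D + \<rho> * r * r"
      unfolding expand u by (simp add: algebra_simps power2_eq_square)
    also have "\<dots> < h x + \<eta> - 2 * \<rho> * r * D + \<epsilon> / 4 * r"
      using z(2) mult_right_mono[OF r(3) less_imp_le[OF r(1)]] by linarith
    finally have up: "h (x + u) < h x + \<eta> - 2 * \<rho> * r * D + \<epsilon> / 4 * r" .
    have "norm (h (x + u) - h x - inner g u) \<le> \<epsilon> / 4 * r"
      using lin[of "x + u"] u r x Rd_add by simp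
    moreover have "\<bar>inner g u\<bar> \<le> \<epsilon> * r"
      using Cauchy_Schwarz_ineq2[of g u] mult_right_mono[OF g(3) less_imp_le[OF r(1)]]
      unfolding u(1) by linarith
    ultimately have "2 * \<rho> * r * D \<le> \<eta> + \<epsilon> / 4 * r + \<epsilon> / 4 * r + \<epsilon> * r"
      using up unfolding real_norm_def by linarith
    moreover have "2 * \<rho> * r * D = 2 * (r * (\<rho> * D))" "\<epsilon> / 4 * r = r * \<epsilon> / 4" "\<epsilon> * r = r * \<epsilon>" by simp_all
    moreover have "0 < r * \<epsilon>" using r pos by simp
    ultimately have "r * (\<rho> * D) \<le> r * \<epsilon>" using \<eta>(2) by linarith
    then show ?thesis using r pos by (simp add: field_simps)
  qed (use pos in simp)
  then obtain w where w: "w \<in> Rd d" "\<tau> \<le> norm w" "norm w \<le> \<epsilon> / \<rho>" "f (z + w) \<le> f z - 4 * \<epsilon> * norm w"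
    using desc[OF z(1)] by (auto simp: D_def norm_minus_commute)
  have "h x \<le> f (z + w) + \<rho> * (norm ((z - x) + w))\<^sup>2"
    using h_le[OF Rd_add[OF z(1) w(1)], of x] by (simp add: norm_minus_commute algebra_simps)
  also have "\<dots> = f (z + w) + \<rho> * D\<^sup>2 + 2 * \<rho> * inner (z - x) w + \<rho> * (norm w)\<^sup>2"
    unfolding expand by (simp add: D_def norm_minus_commute algebra_simps)
  \<comment> \<open>Of the descent 4 \<epsilon> |w|, the cross term consumes 2 and the quadratic
    term 1; the remaining \<epsilon> |w| exceeds the tolerance.\<close>
  also have "\<dots> \<le> f z - 4 * \<epsilon> * norm w + \<rho> * D\<^sup>2 + 2 * \<epsilon> * norm w + \<epsilon> * norm w"
  proof -
    have "\<rho> * inner (z - x) w \<le> \<rho> * (D * norm w)"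
      using norm_cauchy_schwarz[of "z - x" w] pos by (simp add: D_def norm_minus_commute)
    also have "\<dots> \<le> \<epsilon> * norm w"
      using mult_right_mono[OF D, of "\<rho> * norm w"] pos by (simp add: algebra_simps)
    finally have "\<rho> * inner (z - x) w \<le> \<epsilon> * norm w" .
    moreover have "\<rho> * (norm w)\<^sup>2 \<le> \<epsilon> * norm w"
      using mult_right_mono[OF w(3), of "\<rho> * norm w"] pos by (simp add: power2_eq_square algebra_simps)
    ultimately show ?thesis using w(4) by simp
  qed
  also have "\<dots> < h x + \<eta> - \<epsilon> * norm w" using z(2) by (simp add: D_def)
  finally have "\<epsilon> * norm w < \<eta>" by simp
  moreover have "\<epsilon> * \<tau> \<le> \<epsilon> * norm w" using w(2) pos by simp
  ultimately show False using \<eta>(3) by simp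
qed

section \<open>The lower bound\<close>

text \<open>Strong induction: query s lives on the first s coordinates, so its subgradients reach at
  most coordinate s, which is below t.\<close>

lemma query_supp:
  assumes \<Gamma>: "\<Gamma> \<in> zero_respecting" and wc: "weakly_convex d f"
    and reveal: "\<And>k x g. x \<in> Rd d \<Longrightarrow> supp x \<subseteq> {..<k} \<Longrightarrow> g \<in> subdifferential d f x \<Longrightarrow> supp g \<subseteq> {..<Suc k}"
  shows "query \<Gamma> d f t \<in> Rd d" "supp (query \<Gamma> d f t) \<subseteq> {..<t}"
proof -
  show in_Rd: "query \<Gamma> d f t \<in> Rd d" for t
    using \<Gamma> wc by (simp add: zero_respecting_def first_order_algorithms_def)
  show "supp (query \<Gamma> d f t) \<subseteq> {..<t}"
  proof (induction t rule: less_induct)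
    case (less t)
    show ?case
    proof (cases "t = 0")
      case False
      then have "supp (query \<Gamma> d f t) \<subseteq> (\<Union>s<t. \<Union>g\<in>subdifferential d f (query \<Gamma> d f s). supp g)"
        using \<Gamma> wc by (simp add: zero_respecting_def)
      also have "\<dots> \<subseteq> {..<t}"
      proof (intro UN_least)
        fix s g assume "s \<in> {..<t}" and "g \<in> subdifferential d f (query \<Gamma> d f s)"
        then have "supp g \<subseteq> {..<Suc s}" using less.IH[of s] in_Rd by (intro reveal) auto
        then show "supp g \<subseteq> {..<t}" using \<open>s \<in> {..<t}\<close> by auto
      qed
      finally show ?thesis .
    qed (simp add: supp_def)
  qed
qed

lemma complexity_ge:
  assumes "\<And>\<Gamma> t. \<Gamma> \<in> \<A> \<Longrightarrow> t < T \<Longrightarrow> \<not> stationary d \<rho> \<epsilon> f (query \<Gamma> d f t)"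
  shows "enat T \<le> complexity \<rho> \<epsilon> \<A> {(d, f)}"
proof -
  have "enat T \<le> Inf {enat t |t. stationary d \<rho> \<epsilon> f (query \<Gamma> d f t)}" if "\<Gamma> \<in> \<A>" for \<Gamma>
    using assms[OF that] by (intro Inf_greatest) (auto simp flip: not_less)
  then show ?thesis unfolding complexity_def by (intro INF_greatest) simp
qed

section \<open>The rescaled objective\<close>

context chain
begin

text \<open>Slopes scale by A / s and curvatures by A / s^2, so both constants of the class can be
  matched.\<close>

definition objective :: "real \<Rightarrow> real \<Rightarrow> fseq \<Rightarrow> real" where
  "objective A s x = A * hard (\<lambda>i. coord x i / s)"

context
  fixes A s :: real
  assumes A_pos: "0 < A" and s_pos: "0 < s"
begin

lemma objective_lipschitz:
  assumes "N \<le> n\<^sup>2"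
  shows "(4 * A / s)-lipschitz_on (Rd N) (objective A s)"
proof (rule lipschitz_onI)
  have le: "objective A s x - objective A s y \<le> 4 * A / s * dist x y"
    if "x \<in> Rd N" "y \<in> Rd N" for x y
  proof -
    have "L2_set (\<lambda>i. coord x i / s - coord y i / s) {..<N} = L2_set (\<lambda>i. coord (x - y) i * (1 / s)) {..<N}"
      by (simp add: diff_divide_distrib)
    also have "\<dots> = norm (x - y) / s"
      using s_pos Rd_diff[OF that] by (subst L2_set_left_distrib[symmetric]) (simp_all add: norm_Rd)
    finally have "hard (\<lambda>i. coord x i / s) \<le> hard (\<lambda>i. coord y i / s) + 4 * (norm (x - y) / s)"
      using hard_le_hard[OF assms, of "\<lambda>i. coord x i / s" "\<lambda>i. coord y i / s"] by simp
    from mult_left_mono[OF this less_imp_le[OF A_pos]] show ?thesis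
      by (simp add: objective_def dist_norm algebra_simps)
  qed
  fix x y assume "x \<in> Rd N" "y \<in> Rd N"
  then show "dist (objective A s x) (objective A s y) \<le> 4 * A / s * dist x y"
    using le[of x y] le[of y x] by (simp add: dist_real_def abs_le_iff dist_commute)
qed (use A_pos s_pos in simp)

lemma objective_weakly_convex: "weakly_convex_with (2 * A / (n * s\<^sup>2)) N (objective A s)"
proof (rule weakly_convex_withI)
  fix x assume x: "x \<in> Rd N"
  obtain u where u: "\<And>y. hard (\<lambda>i. coord x i / s) + (\<Sum>i<N. u i * (y i - coord x i / s))
      - (\<Sum>i<N. (y i - coord x i / s)\<^sup>2) / n \<le> hard y"
    using hard_weakly_convex by blast
  define g where "g = vec_of N (\<lambda>i. A / s * u i)"
  have "objective A s x + inner g (y - x) - 2 * A / (n * s\<^sup>2) / 2 * (norm (y - x))\<^sup>2 \<le> objective A s y"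
    if y: "y \<in> Rd N" for y
  proof -
    have scale: "coord y i / s - coord x i / s = coord (y - x) i / s" for i
      by (simp add: diff_divide_distrib)
    have "A * (hard (\<lambda>i. coord x i / s) + (\<Sum>i<N. u i * (coord (y - x) i / s))
        - (\<Sum>i<N. (coord (y - x) i / s)\<^sup>2) / n) \<le> objective A s y"
      using mult_left_mono[OF u[of "\<lambda>i. coord y i / s"] less_imp_le[OF A_pos]]
      unfolding scale objective_def .
    moreover have "inner g (y - x) = A * (\<Sum>i<N. u i * (coord (y - x) i / s))"
      unfolding g_def inner_Rd[OF vec_of_Rd] sum_distrib_left by (rule sum.cong) (auto simp: coord_vec_of)
    moreover have "(\<Sum>i<N. (coord (y - x) i / s)\<^sup>2) = (norm (y - x))\<^sup>2 / s\<^sup>2"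
      unfolding norm_Rd[OF Rd_diff[OF y x]]
      by (simp add: L2_set_def sum_nonneg power_divide sum_divide_distrib)
    ultimately show ?thesis by (simp add: objective_def algebra_simps)
  qed
  then show "\<exists>g. \<forall>y\<in>Rd N. objective A s x + inner g (y - x)
      - 2 * A / (n * s\<^sup>2) / 2 * (norm (y - x))\<^sup>2 \<le> objective A s y" by blast
qed

lemma objective_gap: "ereal (objective A s 0) - (INF x\<in>Rd N. ereal (objective A s x)) \<le> ereal (A * (1 + N / n))"
proof -
  have "0 \<le> (INF x\<in>Rd N. ereal (objective A s x))"
    using A_pos by (intro INF_greatest) (simp add: objective_def hard_nonneg)
  then have "ereal (objective A s 0) - (INF x\<in>Rd N. ereal (objective A s x)) \<le> ereal (objective A s 0) - 0"
    by (intro ereal_minus_mono) auto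
  also have "\<dots> \<le> ereal (A * (1 + N / n))"
    using mult_left_mono[OF hard_zero_le less_imp_le[OF A_pos]] by (simp add: objective_def)
  finally show ?thesis .
qed

lemma objective_reveals_next:
  assumes x: "x \<in> Rd N" "supp x \<subseteq> {..<k}" and g: "g \<in> subdifferential N (objective A s) x"
  shows "supp g \<subseteq> {..<Suc k}"
proof
  fix i assume i: "i \<in> supp g"
  have gN: "g \<in> Rd N" using g by (simp add: subdifferential_def)
  have iN: "i < N" using i gN by (auto simp: Rd_def)
  define e where "e = vec_of N (\<lambda>j. if j = i then 1 else 0)"
  have coord_e: "coord e j = (if j = i then 1 else 0)" for j
    using iN by (simp add: e_def coord_vec_of)
  have e: "e \<in> Rd N" by (simp add: e_def vec_of_Rd)
  have "inner e y = coord y i" for y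
    using iN by (simp add: inner_Rd[OF e] coord_e if_distrib[of "\<lambda>c. c * _"] cong: if_cong)
  then have inner_e: "inner y e = coord y i" for y by (metis inner_commute)
  show "i \<in> {..<Suc k}"
  proof (rule ccontr)
    assume "i \<notin> {..<Suc k}"
    then have ki: "k < i" by simp
    have x0: "coord x j / s = 0" if "k \<le> j" for j
      using x(2) that by (force simp: supp_def)
    have "inner g e = 0"
    proof (rule subdifferential_coord_eq_0[OF g x(1) e])
      show "norm e = 1" by (simp add: norm_eq_1 inner_e coord_e)
      show "0 < s / (16 * N)" using s_pos N_pos by simp
      fix t assume t: "\<bar>t\<bar> \<le> s / (16 * N)"
      have "(\<lambda>j. coord (x + t *\<^sub>R e) j / s) = (\<lambda>j. coord x j / s)(i := t / s)"
        using x0[of i] ki s_pos by (auto simp: coord_e fun_eq_iff)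
      moreover have "\<bar>t / s\<bar> \<le> 1 / (16 * N)" using t s_pos by (simp add: abs_divide field_simps)
      ultimately have "hard (\<lambda>j. coord (x + t *\<^sub>R e) j / s) \<le> hard (\<lambda>j. coord x j / s) + 2 * (t / s)\<^sup>2"
        using hard_perturb_unseen[OF x0 ki iN, where t = "t / s"] by simp
      from mult_left_mono[OF this less_imp_le[OF A_pos]]
      show "objective A s (x + t *\<^sub>R e) \<le> objective A s x + (2 * A / s\<^sup>2) * t\<^sup>2"
        by (simp add: objective_def power_divide algebra_simps)
    qed
    then show False using i by (simp add: inner_e supp_def)
  qed
qed

text \<open>\<open>radius\<close> puts the ball of radius \<epsilon> / \<rho>, in units of s, within
  reach of \<open>deficit_sum_gt\<close>; \<open>slope\<close> turns the decrease of
  \<open>hard_descent\<close> into the 4 \<epsilon> that \<open>not_stationaryI\<close> asks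
  for.\<close>

lemma objective_not_stationary:
  assumes pos: "0 < \<rho>" "0 < \<epsilon>" and nN: "n \<le> N" and x: "x \<in> Rd N" "supp x \<subseteq> {..<N - n}"
    and radius: "(\<epsilon> / (\<rho> * s))\<^sup>2 \<le> n / 8" and slope: "4 * \<epsilon> \<le> A / (64 * s * sqrt n)"
  shows "\<not> stationary N \<rho> \<epsilon> (objective A s) x"
proof -
  \<comment> \<open>The second bound gives |w| <= t s sqrt N <= \<epsilon> / \<rho>, as the entries
    of v are at most 1. The choice is independent of z.\<close>
  define t where "t = min (1 / 16) (\<epsilon> / (\<rho> * s * sqrt N))"
  have t: "0 < t" "t \<le> 1 / 16" "t * s * sqrt N \<le> \<epsilon> / \<rho>"
    using pos s_pos N_pos by (auto simp: t_def min_def field_simps)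
  have "\<exists>w\<in>Rd N. t * s / (64 * sqrt N) \<le> norm w \<and> norm w \<le> \<epsilon> / \<rho> \<and>
      objective A s (z + w) \<le> objective A s z - 4 * \<epsilon> * norm w"
    if z: "z \<in> Rd N" "norm (z - x) \<le> \<epsilon> / \<rho>" for z
  proof -
    have "(\<Sum>j<N. (coord z j / s - coord x j / s)\<^sup>2) = (norm (z - x) / s)\<^sup>2"
      unfolding norm_Rd[OF Rd_diff[OF z(1) x(1)]]
      by (simp add: L2_set_def sum_nonneg power_divide sum_divide_distrib flip: diff_divide_distrib)
    also have "\<dots> \<le> (\<epsilon> / \<rho> / s)\<^sup>2"
      using z(2) s_pos by (intro power_mono divide_right_mono) auto
    also have "\<dots> \<le> n / 8" using radius by simp
    finally have "real n / 8 < (\<Sum>j<N. deficit (coord z j / s))"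
      using x(2) by (intro deficit_sum_gt[OF nN, of "\<lambda>j. coord x j / s"]) (force simp: supp_def)+
    from hard_descent[OF this] obtain v where v: "\<And>j. 0 \<le> v j" "\<And>j. v j \<le> 1" "\<And>j. N \<le> j \<Longrightarrow> v j = 0"
        "1 / (64 * sqrt N) \<le> L2_set v {..<N}"
        "hard (\<lambda>j. coord z j / s + t * v j) \<le> hard (\<lambda>j. coord z j / s) - t * L2_set v {..<N} / (64 * sqrt n)"
      using less_imp_le[OF t(1)] t(2) by blast
    define w where "w = vec_of N (\<lambda>j. t * s * v j)"
    have w: "w \<in> Rd N" by (simp add: w_def vec_of_Rd)
    have coord_w: "coord w j = t * s * v j" for j using v(3) by (simp add: w_def coord_vec_of)
    have norm_w: "norm w = t * s * L2_set v {..<N}"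
      unfolding norm_Rd[OF w] coord_w using t s_pos by (intro L2_set_right_distrib[symmetric]) simp
    have "L2_set v {..<N} \<le> L2_set (\<lambda>_. 1) {..<N}" using v by (intro L2_set_mono)
    then have "L2_set v {..<N} \<le> sqrt N" by (simp add: L2_set_constant)
    then have "norm w \<le> t * s * sqrt N" using t s_pos by (simp add: norm_w)
    then have "norm w \<le> \<epsilon> / \<rho>" using t by linarith
    moreover have "t * s / (64 * sqrt N) \<le> norm w"
      using mult_left_mono[OF v(4), of "t * s"] t s_pos by (simp add: norm_w)
    moreover have "objective A s (z + w) \<le> objective A s z - 4 * \<epsilon> * norm w"
    proof -
      have "(\<lambda>j. coord (z + w) j / s) = (\<lambda>j. coord z j / s + t * v j)"
        using s_pos by (simp add: coord_w add_divide_distrib)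
      then have "objective A s (z + w) \<le> A * (hard (\<lambda>j. coord z j / s) - t * L2_set v {..<N} / (64 * sqrt n))"
        using mult_left_mono[OF v(5) less_imp_le[OF A_pos]] by (simp add: objective_def)
      also have "\<dots> = objective A s z - A / (64 * s * sqrt n) * norm w"
        using s_pos by (simp add: objective_def norm_w right_diff_distrib)
      also have "\<dots> \<le> objective A s z - 4 * \<epsilon> * norm w"
        using mult_right_mono[OF slope, of "norm w"] by simp
      finally show ?thesis .
    qed
    ultimately show ?thesis using w by blast
  qed
  moreover have "0 \<le> objective A s z" for z using A_pos by (simp add: objective_def hard_nonneg)
  ultimately show ?thesis
    using pos t s_pos N_pos by (intro not_stationaryI[OF _ _ _ _ x(1), of \<rho> \<epsilon> "t * s / (64 * sqrt N)" 0]) auto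
qed

end

end

section \<open>Choice of the parameters\<close>

theorem theorem3p1:
  shows "\<exists>c\<^sub>0 c\<^sub>1 :: real. c\<^sub>0 > 0 \<and> c\<^sub>1 > 0 \<and>
    (\<forall>G \<rho> \<Delta> \<epsilon> :: real. G > 0 \<and> \<rho> > 0 \<and> \<Delta> > 0 \<and> \<epsilon> > 0 \<and>
       \<epsilon>\<^sup>2 \<le> c\<^sub>0 * min (G\<^sup>2) (\<rho> * \<Delta>) \<longrightarrow>
       (\<exists>(d, f) \<in> function_class G \<rho> \<Delta>.
          ereal_of_enat (complexity \<rho> \<epsilon> zero_respecting {(d, f)})
            \<ge> ereal (c\<^sub>1 * (G\<^sup>2 * min (\<rho> * \<Delta>) (G\<^sup>2) / \<epsilon> ^ 4))))"
proof -
  \<comment> \<open>2^20 = 1024^2, where 1024 = 4 * 256 comes from \<open>slope\<close>: A / (64 s)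
    equals G / 256.\<close>
  define C :: real where "C = 2 ^ 20"
  have C: "0 < C" by (simp add: C_def)
  have main: "\<exists>(d, f) \<in> function_class G \<rho> \<Delta>.
      ereal_of_enat (complexity \<rho> \<epsilon> zero_respecting {(d, f)})
        \<ge> ereal (1 / (8 * C\<^sup>2) * (G\<^sup>2 * min (\<rho> * \<Delta>) (G\<^sup>2) / \<epsilon> ^ 4))"
    if pos: "G > 0" "\<rho> > 0" "\<Delta> > 0" "\<epsilon> > 0"
      and small: "\<epsilon>\<^sup>2 \<le> 1 / (2 * C) * min (G\<^sup>2) (\<rho> * \<Delta>)" for G \<rho> \<Delta> \<epsilon> :: real
  proof -
    \<comment> \<open>Real-valued targets for n and m = N / n. The smallness of \<epsilon> makes
      both at least 2, so rounding down costs only constant factors.\<close>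
    define X where "X = G\<^sup>2 / (C * \<epsilon>\<^sup>2)"
    define Y where "Y = min (\<rho> * \<Delta>) (G\<^sup>2) / (C * \<epsilon>\<^sup>2)"
    have Ce: "0 < C * \<epsilon>\<^sup>2" using C pos by simp
    have Y2: "2 \<le> Y" using small Ce C by (simp add: Y_def field_simps min.commute)
    have YX: "Y \<le> X" unfolding X_def Y_def using Ce by (intro divide_right_mono) auto
    define n where "n = nat \<lfloor>X\<rfloor>"
    define m where "m = nat \<lfloor>Y\<rfloor>"
    have n: "n \<le> X" "X / 2 \<le> n" and m: "m \<le> Y" "Y \<le> m + 1" "2 \<le> m"
      using Y2 YX unfolding n_def m_def by linarith+
    have mn: "m \<le> n" using YX by (simp add: n_def m_def floor_mono nat_mono)
    have n0: "0 < n" using m mn by linarith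
    define N where "N = n * m"
    interpret chain n N by unfold_locales (use n0 m in \<open>auto simp: N_def\<close>)
    \<comment> \<open>The solution of 4 A / s = G and 2 A / (n s^2) = \<rho>.\<close>
    define s where "s = G / (2 * \<rho> * n)"
    define A where "A = G\<^sup>2 / (8 * \<rho> * n)"
    have s: "0 < s" and A: "0 < A" using pos n0 by (auto simp: s_def A_def)
    have "4 * A / s = G" "2 * A / (n * s\<^sup>2) = \<rho>"
      using pos n0 by (simp_all add: A_def s_def power2_eq_square)
    then have lip: "G-lipschitz_on (Rd N) (objective A s)"
      and wc: "weakly_convex_with \<rho> N (objective A s)"
      using objective_lipschitz[OF A s] objective_weakly_convex[OF A s] mn
      by (auto simp: N_def power2_eq_square)
    \<comment> \<open>As N / n = m, the budget \<open>\<Delta>\<close> limits m, while the Lipschitz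
      bound asks for m <= n; hence the minimum in \<open>Y\<close>.\<close>
    have "A * (1 + N / n) \<le> \<Delta>"
    proof -
      have "G\<^sup>2 \<le> 2 * C * \<epsilon>\<^sup>2 * n" using n(2) Ce by (simp add: X_def field_simps)
      then have "G\<^sup>2 * (1 + m) \<le> 2 * C * \<epsilon>\<^sup>2 * n * (2 * Y)"
        using m Y2 C by (intro mult_mono) auto
      also have "\<dots> = 4 * n * (Y * (C * \<epsilon>\<^sup>2))" by simp
      also have "\<dots> \<le> 4 * n * (\<rho> * \<Delta>)"
        using Ce by (intro mult_left_mono) (auto simp: Y_def)
      also have "\<dots> \<le> 8 * n * (\<rho> * \<Delta>)" using pos by simp
      finally have "G\<^sup>2 * (1 + m) \<le> \<Delta> * (8 * \<rho> * n)" by (simp add: algebra_simps)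
      then show ?thesis using pos n0 by (simp add: A_def N_def divide_le_eq)
    qed
    then have gap: "ereal (objective A s 0) - (INF x\<in>Rd N. ereal (objective A s x)) \<le> ereal \<Delta>"
      using objective_gap[OF A s] order_trans ereal_less_eq(3) by blast
    have mem: "(N, objective A s) \<in> function_class G \<rho> \<Delta>"
      using lip wc gap by (simp add: function_class_def)
    have n_le: "C * \<epsilon>\<^sup>2 * n \<le> G\<^sup>2" using n(1) Ce by (simp add: X_def field_simps)
    have radius: "(\<epsilon> / (\<rho> * s))\<^sup>2 \<le> n / 8"
    proof -
      have "\<epsilon> / (\<rho> * s) = 2 * n * \<epsilon> / G" using pos n0 by (simp add: s_def field_simps)
      then have "(\<epsilon> / (\<rho> * s))\<^sup>2 = 4 * n * (\<epsilon>\<^sup>2 * n) / G\<^sup>2"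
        by (simp add: power_divide power_mult_distrib power2_eq_square)
      moreover have "32 * (\<epsilon>\<^sup>2 * n) \<le> G\<^sup>2"
      proof -
        have "32 * (\<epsilon>\<^sup>2 * n) \<le> C * (\<epsilon>\<^sup>2 * n)" by (intro mult_right_mono) (auto simp: C_def)
        then show ?thesis using n_le by (simp add: mult.assoc)
      qed
      then have "n * (32 * (\<epsilon>\<^sup>2 * n)) \<le> n * G\<^sup>2" by (intro mult_left_mono) auto
      ultimately show ?thesis using pos by (simp add: divide_le_eq)
    qed
    have slope: "4 * \<epsilon> \<le> A / (64 * s * sqrt n)"
    proof -
      have "(1024 * \<epsilon> * sqrt n)\<^sup>2 \<le> G\<^sup>2"
        using n_le by (simp add: C_def power_mult_distrib)
      then have "1024 * \<epsilon> * sqrt n \<le> G" by (rule power2_le_imp_le) (use pos in simp)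
      moreover have "A / (64 * s * sqrt n) = G / (256 * sqrt n)"
        using pos n0 by (simp add: A_def s_def power2_eq_square)
      moreover have "4 * \<epsilon> \<le> G / (256 * sqrt n)"
        using calculation(1) n0 by (simp add: pos_le_divide_eq mult_ac)
      ultimately show ?thesis by simp
    qed
    \<comment> \<open>Before query N - n, at least n coordinates are still untouched.\<close>
    have "enat (N - n) \<le> complexity \<rho> \<epsilon> zero_respecting {(N, objective A s)}"
    proof (rule complexity_ge)
      fix \<Gamma> t assume \<Gamma>: "\<Gamma> \<in> zero_respecting" and t: "t < N - n"
      have wc': "weakly_convex N (objective A s)" using wc pos by (auto simp: weakly_convex_def)
      have q: "query \<Gamma> N (objective A s) t \<in> Rd N" "supp (query \<Gamma> N (objective A s) t) \<subseteq> {..<t}"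
        by (rule query_supp[OF \<Gamma> wc' objective_reveals_next[OF A s]]; assumption)+
      moreover have "n \<le> N" using m by (simp add: N_def)
      moreover have "{..<t} \<subseteq> {..<N - n}" using t by auto
      ultimately show "\<not> stationary N \<rho> \<epsilon> (objective A s) (query \<Gamma> N (objective A s) t)"
        using radius slope by (intro objective_not_stationary[OF A s pos(2,4)]) auto
    qed
    then have "ereal (real (N - n)) \<le> ereal_of_enat (complexity \<rho> \<epsilon> zero_respecting {(N, objective A s)})"
      by (metis ereal_of_enat_le_iff ereal_of_enat_simps(1))
    moreover have "1 / (8 * C\<^sup>2) * (G\<^sup>2 * min (\<rho> * \<Delta>) (G\<^sup>2) / \<epsilon> ^ 4) \<le> N - n"
    proof -
      have "1 / (8 * C\<^sup>2) * (G\<^sup>2 * min (\<rho> * \<Delta>) (G\<^sup>2) / \<epsilon> ^ 4) = X / 2 * (Y / 4)"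
        by (simp add: X_def Y_def power2_eq_square power4_eq_xxxx)
      \<comment> \<open>4 (m - 1) >= m + 1 >= Y because m >= 2.\<close>
      also have "\<dots> \<le> n * (real m - 1)"
        using n m Y2 YX by (intro mult_mono) auto
      also have "\<dots> = real (N - n)" using m by (simp add: N_def of_nat_diff algebra_simps)
      finally show ?thesis by simp
    qed
    ultimately have "ereal (1 / (8 * C\<^sup>2) * (G\<^sup>2 * min (\<rho> * \<Delta>) (G\<^sup>2) / \<epsilon> ^ 4))
        \<le> ereal_of_enat (complexity \<rho> \<epsilon> zero_respecting {(N, objective A s)})"
      using order_trans[OF iffD2[OF ereal_less_eq(3)]] by blast
    then show ?thesis by (intro bexI[OF _ mem]) (simp only: prod.case)
  qed
  show ?thesis
    using main C by (intro exI[of _ "1 / (2 * C)"] exI[of _ "1 / (8 * C\<^sup>2)"]) simp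
qed

end
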